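(* Let $X$ and $Y$ be Tychonoff spaces, let $m$ be a positive integer, and let $T:D_p(X)\to D_p(Y)$ be a surjective continuous linear map such that $|\mathrm{supp}(y)|\leq m$ for every $y\in Y$. Then $\dim Y\leq m\cdot\dim X$.
   Context: For a Tychonoff space $X$, $C(X)$ is the linear space of all continuous real-valued functions on $X$ and $C^*(X)$ is its subspace of bounded functions. $D(X)$ denotes either $C(X)$ or $C^*(X)$, and $D(Y)$ denotes either $C(Y)$ or $C^*(Y)$; the two choices are independent (so there are four possible cases, and the result is asserted in each of them). $D_p(X)$ is $D(X)$ endowed with the topology of pointwise convergence. $\dim$ is the covering dimension: for a Tychonoff space $X$ and an integer $n\ge 0$, $\dim X\leq n$ if every finite functionally open (i.e. cozero) cover of $X$ has a finite functionally open refinement of order $\leq n$ (i.e. every point lies in at most $n+1$ members). For $y\in Y$, the support $\mathrm{supp}(y)$ (with respect to $T$) is the set of all points $x\in\beta X$ (the Čech–Stone compactification of $X$) such that for every neighborhood $U$ of $x$ in $\beta X$ there is $f\in D(X)$ with $f(X\setminus U)=0$ and $T(f)(y)\neq 0$. *)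

theory Defs
  imports "HOL-Analysis.Analysis"
begin

definition tychonoff_space :: "'a topology \<Rightarrow> bool" where
  "tychonoff_space X \<longleftrightarrow> completely_regular_space X \<and> Hausdorff_space X"


section \<open>Function spaces\<close>

text \<open>A real-valued function on X is represented by its extensional version, which is undefined
  outside the carrier; this is also the representation used by \<^const>\<open>product_topology\<close>.\<close>

definition C_space :: "'a topology \<Rightarrow> ('a \<Rightarrow> real) set" where
  "C_space X = {f \<in> extensional (topspace X). continuous_map X euclideanreal f}"

definition Cb_space :: "'a topology \<Rightarrow> ('a \<Rightarrow> real) set" where
  "Cb_space X = {f \<in> C_space X. bounded (f ` topspace X)}"

definition pointwise_topology :: "'a topology \<Rightarrow> ('a \<Rightarrow> real) set \<Rightarrow> ('a \<Rightarrow> real) topology" where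
  "pointwise_topology X D = subtopology (powertop_real (topspace X)) D"

definition linear_map_on ::
    "'a topology \<Rightarrow> 'b topology \<Rightarrow> ('a \<Rightarrow> real) set \<Rightarrow> (('a \<Rightarrow> real) \<Rightarrow> ('b \<Rightarrow> real)) \<Rightarrow> bool" where
  "linear_map_on X Y D T \<longleftrightarrow>
     (\<forall>f\<in>D. \<forall>g\<in>D. T (\<lambda>x\<in>topspace X. f x + g x) = (\<lambda>y\<in>topspace Y. T f y + T g y)) \<and>
     (\<forall>c. \<forall>f\<in>D. T (\<lambda>x\<in>topspace X. c * f x) = (\<lambda>y\<in>topspace Y. c * T f y))"


section \<open>Covering dimension\<close>

definition functionally_open :: "'a topology \<Rightarrow> 'a set \<Rightarrow> bool" where
  "functionally_open X U \<longleftrightarrow>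
     (\<exists>f. continuous_map X euclideanreal f \<and> U = {x \<in> topspace X. f x \<noteq> 0})"

definition finite_functionally_open_cover :: "'a topology \<Rightarrow> 'a set set \<Rightarrow> bool" where
  "finite_functionally_open_cover X \<U> \<longleftrightarrow>
     finite \<U> \<and> (\<forall>U\<in>\<U>. functionally_open X U) \<and> \<Union>\<U> = topspace X"

definition covering_dim_le :: "'a topology \<Rightarrow> nat \<Rightarrow> bool" where
  "covering_dim_le X n \<longleftrightarrow>
     (\<forall>\<U>. finite_functionally_open_cover X \<U> \<longrightarrow>
        (\<exists>\<V>. finite_functionally_open_cover X \<V> \<and>
             (\<forall>V\<in>\<V>. \<exists>U\<in>\<U>. V \<subseteq> U) \<and>
             (\<forall>x\<in>topspace X. card {V \<in> \<V>. x \<in> V} \<le> n + 1)))"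

text \<open>The value is \<^term>\<open>\<infinity>\<close> if no bound holds, and 0 for the empty space.\<close>

definition covering_dim :: "'a topology \<Rightarrow> enat" where
  "covering_dim X = Inf {enat n |n. covering_dim_le X n}"


section \<open>The Cech-Stone compactification\<close>

text \<open>As usual, it is constructed as the closure of the image of X under the evaluation map into
  the cube indexed by all continuous functions from X to the unit interval.\<close>

definition unit_functions :: "'a topology \<Rightarrow> ('a \<Rightarrow> real) set" where
  "unit_functions X = {f \<in> C_space X. f ` topspace X \<subseteq> {0..1}}"

definition unit_cube :: "'a topology \<Rightarrow> (('a \<Rightarrow> real) \<Rightarrow> real) topology" where
  "unit_cube X = product_topology (\<lambda>f. top_of_set {0..1}) (unit_functions X)"

definition beta_embed :: "'a topology \<Rightarrow> 'a \<Rightarrow> (('a \<Rightarrow> real) \<Rightarrow> real)" where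
  "beta_embed X x = (\<lambda>f\<in>unit_functions X. f x)"

definition beta_space :: "'a topology \<Rightarrow> (('a \<Rightarrow> real) \<Rightarrow> real) topology" where
  "beta_space X = subtopology (unit_cube X) (unit_cube X closure_of (beta_embed X ` topspace X))"

lemma beta_embed_in_cube:
  assumes "x \<in> topspace X"
  shows "beta_embed X x \<in> topspace (unit_cube X)"
  using assms by (auto simp: beta_embed_def unit_cube_def unit_functions_def)

lemma compact_beta_space: "compact_space (beta_space X)"
proof -
  have "compact_space (unit_cube X)"
    unfolding unit_cube_def compact_space_product_topology
    by (simp add: compact_space_subtopology)
  then show ?thesis
    unfolding beta_space_def
    by (intro compact_space_subtopology closedin_compact_space) auto
qed

lemma Hausdorff_beta_space: "Hausdorff_space (beta_space X)"
  unfolding beta_space_def unit_cube_def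
  by (intro Hausdorff_space_subtopology)
     (simp add: Hausdorff_space_product_topology Hausdorff_space_subtopology)

lemma beta_embed_dense: "beta_space X closure_of (beta_embed X ` topspace X) = topspace (beta_space X)"
proof -
  let ?A = "beta_embed X ` topspace X"
  have "?A \<subseteq> unit_cube X closure_of ?A"
    by (intro closure_of_subset) (auto intro: beta_embed_in_cube)
  then show ?thesis
    unfolding beta_space_def
    by (simp add: closure_of_subtopology Int_absorb1 closure_of_subset_topspace)
qed

lemma beta_embed_embedding:
  assumes "tychonoff_space X"
  shows "embedding_map X (beta_space X) (beta_embed X)"
proof -
  have K: "mspace (submetric (cfunspace X euclidean_metric) {f. f \<in> topspace X \<rightarrow> {0..1}})
      = unit_functions X"
    by (auto simp: unit_functions_def C_space_def image_subset_iff_funcset Pi_iff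
        intro: bounded_subset[OF bounded_closed_interval[of 0 1]])
  have "embedding_map X (unit_cube X) (beta_embed X)"
    using completely_regular_space_cube_embedding_explicit[of X] assms
    unfolding K tychonoff_space_def unit_cube_def beta_embed_def by simp
  moreover have "beta_embed X ` topspace X \<subseteq> unit_cube X closure_of (beta_embed X ` topspace X)"
    by (intro closure_of_subset) (auto intro: beta_embed_in_cube)
  ultimately show ?thesis
    unfolding beta_space_def by (simp add: embedding_map_in_subtopology)
qed

lemma beta_extension:
  assumes "f \<in> Cb_space X"
  obtains F where "continuous_map (beta_space X) euclideanreal F"
    and "\<And>x. x \<in> topspace X \<Longrightarrow> F (beta_embed X x) = f x"
proof -
  obtain b where b: "b > 0" "\<And>x. x \<in> topspace X \<Longrightarrow> \<bar>f x\<bar> \<le> b"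
    using assms unfolding Cb_space_def bounded_pos by auto
  define g where "g = (\<lambda>x\<in>topspace X. (f x + b) / (2 * b))"
  have f: "continuous_map X euclideanreal f"
    using assms by (simp add: Cb_space_def C_space_def)
  have "continuous_map X euclideanreal (\<lambda>x. (f x + b) / (2 * b))"
    using b by (intro continuous_intros f) auto
  then have "continuous_map X euclideanreal g"
    by (rule continuous_map_eq) (simp add: g_def)
  moreover have "g x \<in> {0..1}" if "x \<in> topspace X" for x
    using b(1) b(2)[OF that] that by (auto simp: g_def field_simps)
  ultimately have g: "g \<in> unit_functions X"
    by (auto simp: unit_functions_def C_space_def g_def)
  have "continuous_map (unit_cube X) (top_of_set {0..1}) (\<lambda>p. p g)"
    unfolding unit_cube_def using g by (rule continuous_map_product_projection)
  then have "continuous_map (beta_space X) euclideanreal (\<lambda>p. p g)"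
    unfolding beta_space_def
    by (metis continuous_map_from_subtopology continuous_map_in_subtopology)
  then have "continuous_map (beta_space X) euclideanreal (\<lambda>p. 2 * b * p g - b)"
    by (intro continuous_intros) auto
  moreover have "2 * b * beta_embed X x g - b = f x" if "x \<in> topspace X" for x
    using b(1) g that by (simp add: beta_embed_def g_def)
  ultimately show ?thesis
    using that by blast
qed


section \<open>Supports\<close>

text \<open>Here D is the domain of T. The points of X are identified with their images under
  \<^const>\<open>beta_embed\<close>.\<close>

definition supp ::
    "'a topology \<Rightarrow> ('a \<Rightarrow> real) set \<Rightarrow> (('a \<Rightarrow> real) \<Rightarrow> ('b \<Rightarrow> real)) \<Rightarrow> 'b \<Rightarrow> (('a \<Rightarrow> real) \<Rightarrow> real) set"
  where
  "supp X D T y =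
     {p \<in> topspace (beta_space X).
        \<forall>U. openin (beta_space X) U \<and> p \<in> U \<longrightarrow>
          (\<exists>f\<in>D. (\<forall>x\<in>topspace X. beta_embed X x \<notin> U \<longrightarrow> f x = 0) \<and> T f y \<noteq> 0)}"

end

(* Every point y of Y defines a functional f |-> T f y on the function space of X, which is a linear
   combination of at most m evaluations. Given a cover of Y by functions h_1, ..., h_s with values in
   [0, 1] and maximum 1, finitely many bump functions of the h_j are images T f, and the functions f
   are nearly constant on the members of suitable families of cozero sets in X. With m n + 1 such
   families of disjoint sets (colours), each point of X is missed by at most n of them, so all atoms of
   a given y lie in the union of one family. The points of Y whose atoms lie in the same k members of
   a family then form a cell on which, by a rank argument, the values of the h_j are confined to few
   small clusters; hence the cell splits into disjoint pieces subordinate to the cover. One disjoint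
   family of pieces for each colour gives order m n + 1. Stratifying Y by the number of atoms and the
   norm of the functional makes the cells open, and a countable sum argument joins the strata. *)
theory Submission
  imports Defs
begin

section \<open>Cozero sets and function spaces\<close>

text \<open>The number of atoms and the norm of the functional at y are only lower semicontinuous in
  y, and the atoms themselves need not depend continuously on y. As X and Y need not be normal, a
  condition on y is usable only if it can be tested by countably many values \<open>T f y\<close>,
  so that it cuts out a cozero or a zero set. Hence everything is relative to a countable set of
  functions on X, which sees a functional only up to merging of atoms; this set depends on the cover
  at hand and is enlarged as the cover is refined. The norm matters because the rank argument is
  quantitative: replacing a function by its value at one point of each member of a family costs at
  most (number of atoms) * (bound on the weights) * (oscillation), and summed over as many functions
  as there are thresholds this must stay below 1. So the oscillation is chosen after the norm bound.
  The preimages under T may be unbounded, which is why the families in X are countable rather than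
  finite.\<close>

lemma functionally_open_neq:
  assumes "continuous_map X euclideanreal f" "continuous_map X euclideanreal g"
  shows "functionally_open X {x \<in> topspace X. f x \<noteq> g x}"
  unfolding functionally_open_def using continuous_map_diff[OF assms] by (intro exI[of _ "\<lambda>x. f x - g x"]) auto

lemma functionally_open_less:
  assumes "continuous_map X euclideanreal f" "continuous_map X euclideanreal g"
  shows "functionally_open X {x \<in> topspace X. f x < g x}"
  unfolding functionally_open_def
  by (intro exI[of _ "\<lambda>x. max 0 (g x - f x)"] conjI continuous_intros assms) auto

lemma functionally_open_subset: "functionally_open X U \<Longrightarrow> U \<subseteq> topspace X"
  unfolding functionally_open_def by auto

lemma functionally_open_witness:
  assumes "functionally_open X U"
  obtains f :: "'a \<Rightarrow> real" where "continuous_map X euclideanreal f" "\<And>x. 0 \<le> f x" "\<And>x. f x \<le> 1"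
    "U = {x \<in> topspace X. 0 < f x}"
proof -
  obtain f where f: "continuous_map X euclideanreal f" "U = {x \<in> topspace X. f x \<noteq> 0}"
    using assms unfolding functionally_open_def by auto
  show ?thesis
    by (rule that[of "\<lambda>x. min 1 \<bar>f x\<bar>"]) (use f in \<open>auto intro!: continuous_intros\<close>)
qed

lemma functionally_open_topspace: "functionally_open X (topspace X)"
  unfolding functionally_open_def by (intro exI[of _ "\<lambda>_. 1"]) auto

lemma functionally_open_empty: "functionally_open X {}"
  unfolding functionally_open_def by (intro exI[of _ "\<lambda>_. 0"]) auto

lemma functionally_open_Int:
  assumes "functionally_open X U" "functionally_open X V"
  shows "functionally_open X (U \<inter> V)"
proof -
  obtain f g where "continuous_map X euclideanreal f" "U = {x \<in> topspace X. f x \<noteq> 0}"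
    "continuous_map X euclideanreal g" "V = {x \<in> topspace X. g x \<noteq> 0}"
    using assms unfolding functionally_open_def by auto
  then show ?thesis
    unfolding functionally_open_def
    by (intro exI[of _ "\<lambda>x. f x * g x"] conjI continuous_intros) auto
qed

lemma functionally_open_finite_Inter:
  assumes "finite I" "\<And>i. i \<in> I \<Longrightarrow> functionally_open X (U i)"
  shows "functionally_open X {x \<in> topspace X. \<forall>i\<in>I. x \<in> U i}"
  using assms
proof (induction I rule: finite_induct)
  case empty
  then show ?case by (simp add: functionally_open_topspace)
next
  case (insert i I)
  have "{x \<in> topspace X. \<forall>j\<in>insert i I. x \<in> U j} = U i \<inter> {x \<in> topspace X. \<forall>j\<in>I. x \<in> U j}"
    using functionally_open_subset[OF insert.prems, of i] by auto
  then show ?case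
    using insert by (simp add: functionally_open_Int)
qed

text \<open>With weights (1/2)^i, the series of nonnegative witnesses bounded by 1 converges
  uniformly, so its sum is continuous, and it vanishes exactly where all of them do.\<close>

lemma functionally_open_UN_nat:
  fixes U :: "nat \<Rightarrow> 'a set"
  assumes "\<And>i. functionally_open X (U i)"
  shows "functionally_open X (\<Union>i. U i)"
proof -
  have "\<exists>f. continuous_map X euclideanreal f \<and> (\<forall>x. 0 \<le> f x \<and> f x \<le> 1) \<and> U i = {x \<in> topspace X. 0 < f x}" for i
    by (metis functionally_open_witness[OF assms[of i]])
  then obtain f where f: "\<And>i. continuous_map X euclideanreal (f i)" "\<And>i x. 0 \<le> f i x" "\<And>i x. f i x \<le> 1"
    "\<And>i. U i = {x \<in> topspace X. 0 < f i x}"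
    by metis
  define g where "g x = (\<Sum>i. (1/2) ^ i * f i x)" for x
  have sum: "summable (\<lambda>i. (1/2) ^ i * f i x)" for x
    by (rule summable_comparison_test'[of "\<lambda>i. (1/2) ^ i"])
       (use f in \<open>auto simp: summable_geometric mult_left_le\<close>)
  have lim: "uniform_limit (topspace X) (\<lambda>n x. \<Sum>i<n. (1/2) ^ i * f i x) g sequentially"
    unfolding g_def
    by (rule Weierstrass_m_test[of _ _ "\<lambda>i. (1/2) ^ i"])
       (use f in \<open>auto simp: summable_geometric mult_left_le\<close>)
  have "continuous_map X Met_TC.mtopology g"
  proof (rule Met_TC.continuous_map_uniform_limit[where f = "\<lambda>n x. \<Sum>i<n. (1/2) ^ i * f i x" and F = sequentially])
    show "\<forall>\<^sub>F n in sequentially. continuous_map X Met_TC.mtopology (\<lambda>x. \<Sum>i<n. (1/2) ^ i * f i x)"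
      by (intro always_eventually allI, simp, intro continuous_intros) (use f in auto)
    show "\<forall>\<^sub>F n in sequentially. \<forall>x\<in>topspace X. g x \<in> UNIV \<and> dist (\<Sum>i<n. (1/2) ^ i * f i x) (g x) < e"
      if "0 < e" for e
      using uniform_limitD[OF lim that] by simp
  qed auto
  then have "continuous_map X euclideanreal g" by simp
  moreover have "g x \<noteq> 0 \<longleftrightarrow> (\<exists>i. 0 < f i x)" for x
    unfolding g_def using suminf_eq_zero_iff[OF sum[of x]] f(2)[of _ x] less_le[of 0 "f _ x"]
    by auto
  ultimately show ?thesis
    unfolding functionally_open_def by (intro exI[of _ g]) (auto simp: f(4))
qed

lemma functionally_open_countable_Union:
  assumes "countable I" "\<And>i. i \<in> I \<Longrightarrow> functionally_open X (U i)"
  shows "functionally_open X (\<Union>i\<in>I. U i)"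
proof (cases "I = {}")
  case True
  then show ?thesis by (simp add: functionally_open_empty)
next
  case False
  have "(\<Union>i\<in>I. U i) = (\<Union>n. U (from_nat_into I n))"
    using range_from_nat_into[OF False assms(1)] by (metis image_image)
  then show ?thesis
    using functionally_open_UN_nat[of X "\<lambda>n. U (from_nat_into I n)"] assms(2) False
    by (simp add: from_nat_into)
qed

lemma functionally_open_countable_Ex:
  assumes "countable I" "\<And>i. i \<in> I \<Longrightarrow> functionally_open X {x \<in> topspace X. P i x}"
  shows "functionally_open X {x \<in> topspace X. \<exists>i\<in>I. P i x}"
proof -
  have "{x \<in> topspace X. \<exists>i\<in>I. P i x} = (\<Union>i\<in>I. {x \<in> topspace X. P i x})" by auto
  then show ?thesis using functionally_open_countable_Union[OF assms] by simp
qed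

lemma functionally_open_finite_All:
  assumes "finite I" "\<And>i. i \<in> I \<Longrightarrow> functionally_open X {x \<in> topspace X. P i x}"
  shows "functionally_open X {x \<in> topspace X. \<forall>i\<in>I. P i x}"
  using functionally_open_finite_Inter[of I X "\<lambda>i. {x \<in> topspace X. P i x}"] assms
  by (simp add: conj_commute cong: conj_cong)

lemma functionally_open_conj:
  assumes "functionally_open X {x \<in> topspace X. P x}" "functionally_open X {x \<in> topspace X. Q x}"
  shows "functionally_open X {x \<in> topspace X. P x \<and> Q x}"
proof -
  have "{x \<in> topspace X. P x \<and> Q x} = {x \<in> topspace X. P x} \<inter> {x \<in> topspace X. Q x}" by auto
  then show ?thesis using functionally_open_Int[OF assms] by simp
qed

lemma functionally_open_disj:
  assumes "functionally_open X {x \<in> topspace X. P x}" "functionally_open X {x \<in> topspace X. Q x}"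
  shows "functionally_open X {x \<in> topspace X. P x \<or> Q x}"
proof -
  have "{x \<in> topspace X. P x \<or> Q x} = (\<Union>b\<in>{False, True}. if b then {x \<in> topspace X. P x} else {x \<in> topspace X. Q x})"
    by auto
  also have "functionally_open X \<dots>"
    by (rule functionally_open_countable_Union) (use assms in auto)
  finally show ?thesis .
qed

text \<open>Dividing by a sum instead of a maximum avoids maxima of finite families of functions; the
  factor \<^term>\<open>card J\<close> still makes the largest of the truncated quotients equal to 1.\<close>

lemma functionally_open_cover_normalise:
  assumes "finite J" "\<And>j. j \<in> J \<Longrightarrow> functionally_open X (U j)" "(\<Union>j\<in>J. U j) = topspace X"
  obtains g :: "'i \<Rightarrow> 'a \<Rightarrow> real" where "\<And>j. j \<in> J \<Longrightarrow> continuous_map X euclideanreal (g j)"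
    "\<And>j. j \<in> J \<Longrightarrow> U j = {x \<in> topspace X. 0 < g j x}"
    "\<And>x. x \<in> topspace X \<Longrightarrow> \<exists>j\<in>J. g j x = 1"
    "\<And>j x. j \<in> J \<Longrightarrow> x \<in> topspace X \<Longrightarrow> 0 \<le> g j x \<and> g j x \<le> 1"
proof -
  have "\<forall>j\<in>J. \<exists>f. continuous_map X euclideanreal f \<and> (\<forall>x. 0 \<le> f x \<and> f x \<le> 1) \<and> U j = {x \<in> topspace X. 0 < f x}"
    by (metis functionally_open_witness assms(2))
  then obtain u where u: "\<And>j. j \<in> J \<Longrightarrow> continuous_map X euclideanreal (u j)"
    "\<And>j x. j \<in> J \<Longrightarrow> 0 \<le> u j x" "\<And>j. j \<in> J \<Longrightarrow> U j = {x \<in> topspace X. 0 < u j x}"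
    by metis
  define s where "s x = (\<Sum>j\<in>J. u j x)" for x
  have s: "0 < s x" if "x \<in> topspace X" for x
  proof -
    have "x \<in> (\<Union>j\<in>J. U j)" using that assms(3) by simp
    then obtain j where j: "j \<in> J" "x \<in> U j" by (rule UN_E)
    then have *: "0 < u j x" using u(3)[of j] by simp
    show ?thesis unfolding s_def by (rule sum_pos2[of J j]) (simp_all add: assms(1) j(1) * u(2))
  qed
  have cs: "continuous_map X euclideanreal s"
    unfolding s_def by (intro continuous_intros u assms)
  define g where "g j x = min 1 (real (card J) * u j x / s x)" for j x
  \<comment> \<open>If every \<open>card J * u j x\<close> were below \<open>s x\<close>, summing
    over J would give \<open>card J * s x < card J * s x\<close>.\<close>
  have le: "\<exists>j\<in>J. s x \<le> real (card J) * u j x" if "x \<in> topspace X" for x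
  proof (rule ccontr)
    assume "\<not> ?thesis"
    then have *: "real (card J) * u j x < s x" if "j \<in> J" for j
      using that by (simp add: not_le)
    have "J \<noteq> {}" using assms(3) that by auto
    then have "(\<Sum>j\<in>J. real (card J) * u j x) < (\<Sum>j\<in>J. s x)"
      using * assms(1) by (intro sum_strict_mono)
    then show False by (simp add: s_def sum_distrib_left)
  qed
  show ?thesis
  proof (rule that[of g])
    show "continuous_map X euclideanreal (g j)" if "j \<in> J" for j
      unfolding g_def by (intro continuous_intros cs u that) (use s in force)
    show "U j = {x \<in> topspace X. 0 < g j x}" if "j \<in> J" for j
    proof -
      have "0 < card J" using that assms(1) by (auto simp: card_gt_0_iff)
      then show ?thesis
        using s that by (auto simp: u(3) g_def zero_less_divide_iff zero_less_mult_iff dest: less_asym)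
    qed
    show "\<exists>j\<in>J. g j x = 1" if x: "x \<in> topspace X" for x
    proof -
      obtain j where "j \<in> J" "s x \<le> real (card J) * u j x" using le[OF x] by blast
      then show ?thesis using s[OF x] by (intro bexI[of _ j]) (auto simp: g_def min_def field_simps)
    qed
    show "0 \<le> g j x \<and> g j x \<le> 1" if "j \<in> J" "x \<in> topspace X" for j x
      using s[OF that(2)] u(2)[OF that(1)] by (auto simp: g_def)
  qed
qed

section \<open>Closure properties of C(X) and C*(X), and bump functions\<close>

lemma Cb_space_iff: "f \<in> Cb_space X \<longleftrightarrow> f \<in> C_space X \<and> (\<exists>b. \<forall>x\<in>topspace X. \<bar>f x\<bar> \<le> b)"
  by (auto simp: Cb_space_def bounded_iff)

lemma function_space_add:
  assumes "D = C_space X \<or> D = Cb_space X" "f \<in> D" "g \<in> D"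
  shows "(\<lambda>x\<in>topspace X. f x + g x) \<in> D"
proof -
  have C: "f \<in> C_space X" "g \<in> C_space X" using assms by (auto simp: Cb_space_def)
  have "continuous_map X euclideanreal (\<lambda>x. f x + g x)"
    using C by (intro continuous_intros) (auto simp: C_space_def)
  then have 1: "(\<lambda>x\<in>topspace X. f x + g x) \<in> C_space X"
    by (auto simp: C_space_def intro: continuous_map_eq)
  have "\<exists>b. \<forall>x\<in>topspace X. \<bar>f x + g x\<bar> \<le> b" if "\<forall>x\<in>topspace X. \<bar>f x\<bar> \<le> b1" "\<forall>x\<in>topspace X. \<bar>g x\<bar> \<le> b2" for b1 b2
    using that by (intro exI[of _ "b1 + b2"]) (smt (verit))
  then show ?thesis using assms 1 by (auto simp: Cb_space_iff)
qed

lemma function_space_scale: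
  assumes "D = C_space X \<or> D = Cb_space X" "f \<in> D"
  shows "(\<lambda>x\<in>topspace X. c * f x) \<in> D"
proof -
  have C: "f \<in> C_space X" using assms by (auto simp: Cb_space_def)
  have "continuous_map X euclideanreal (\<lambda>x. c * f x)"
    using C by (intro continuous_intros) (auto simp: C_space_def)
  then have 1: "(\<lambda>x\<in>topspace X. c * f x) \<in> C_space X"
    by (auto simp: C_space_def intro: continuous_map_eq)
  have "\<exists>b. \<forall>x\<in>topspace X. \<bar>c * f x\<bar> \<le> b" if "\<forall>x\<in>topspace X. \<bar>f x\<bar> \<le> b" for b
    using that by (intro exI[of _ "\<bar>c\<bar> * b"]) (auto simp: abs_mult intro: mult_left_mono)
  then show ?thesis using assms 1 by (auto simp: Cb_space_iff)
qed

lemma restrict_in_Cb_space: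
  assumes "continuous_map X euclideanreal f" "\<And>x. x \<in> topspace X \<Longrightarrow> \<bar>f x\<bar> \<le> b"
  shows "restrict f (topspace X) \<in> Cb_space X"
  using assms by (auto simp: Cb_space_iff C_space_def intro: continuous_map_eq)

text \<open>Finite sets are closed in a Hausdorff space, so the unwanted points can be added to the
  complement of U before complete regularity is applied. The bump serves to isolate one atom of a
  finite sum.\<close>

lemma tychonoff_bump:
  assumes X: "tychonoff_space X" and "openin X U" "x \<in> U" "finite S"
  obtains h where "h \<in> Cb_space X" "h x = 1" "\<And>z. z \<in> topspace X \<Longrightarrow> z \<notin> U \<Longrightarrow> h z = 0"
    "\<And>z. z \<in> S \<Longrightarrow> z \<in> topspace X \<Longrightarrow> z \<noteq> x \<Longrightarrow> h z = 0"
proof -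
  define C where "C = (topspace X - U) \<union> (S \<inter> topspace X - {x})"
  have "closedin X (S \<inter> topspace X - {x})"
    using X \<open>finite S\<close> by (intro closedin_Hausdorff_finite) (auto simp: tychonoff_space_def)
  then have "closedin X C" unfolding C_def using \<open>openin X U\<close> by (intro closedin_Un closedin_diff[OF closedin_topspace])
  moreover have xX: "x \<in> topspace X" using assms(2,3) openin_subset by blast
  moreover have "x \<notin> C" using assms(3) by (simp add: C_def)
  ultimately obtain f where f: "continuous_map X (top_of_set {0..1::real}) f" "f x = 0" "f ` C \<subseteq> {1}"
    using X unfolding tychonoff_space_def completely_regular_space_def by (metis DiffI)
  have cf: "continuous_map X euclideanreal f" and rf: "\<And>z. z \<in> topspace X \<Longrightarrow> f z \<in> {0..1}"
    using f(1) by (auto simp: continuous_map_in_subtopology)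
  have "continuous_map X euclideanreal (\<lambda>z. 1 - f z)"
    by (intro continuous_intros cf) auto
  then have "restrict (\<lambda>z. 1 - f z) (topspace X) \<in> Cb_space X"
    by (rule restrict_in_Cb_space[where b = 1]) (use rf in force)
  then show ?thesis
    by (rule that) (use f xX in \<open>auto simp: C_def\<close>)
qed

section \<open>Coloured families and test functions\<close>

lemma functionally_open_cover_refine:
  assumes "covering_dim_le X n" "finite J" "\<And>j. j \<in> J \<Longrightarrow> functionally_open X (U j)" "(\<Union>j\<in>J. U j) = topspace X"
  obtains \<V> where "finite_functionally_open_cover X \<V>" "\<And>V. V \<in> \<V> \<Longrightarrow> \<exists>j\<in>J. V \<subseteq> U j"
    "\<And>x. x \<in> topspace X \<Longrightarrow> card {V \<in> \<V>. x \<in> V} \<le> n + 1"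
proof -
  have "finite_functionally_open_cover X (U ` J)"
    using assms(2-4) unfolding finite_functionally_open_cover_def by auto
  then obtain \<V> where "finite_functionally_open_cover X \<V>" "\<forall>V\<in>\<V>. \<exists>W\<in>U ` J. V \<subseteq> W"
    "\<forall>x\<in>topspace X. card {V \<in> \<V>. x \<in> V} \<le> n + 1"
    using assms(1) unfolding covering_dim_le_def by blast
  then show ?thesis using that[of \<V>] by blast
qed

text \<open>An Ostrand-type description of dimension. Each colour c uses the level sets of a partition of
  unity at a threshold of its own. If the largest member of the partition is normalised to be 1, then
  at most n of its values at a point are strictly between 0 and 1, so at most n thresholds are hit.\<close>

lemma covering_dim_coloured_families:
  fixes F :: "('a \<Rightarrow> real) set" and R :: nat
  assumes dim: "covering_dim_le X n" and F: "finite F" "\<And>f. f \<in> F \<Longrightarrow> continuous_map X euclideanreal f"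
    and "0 < \<delta>"
  obtains \<D> :: "nat \<Rightarrow> 'a set set" where
    "\<And>c. countable (\<D> c)" "\<And>c. disjoint (\<D> c)"
    "\<And>c D. D \<in> \<D> c \<Longrightarrow> functionally_open X D"
    "\<And>c D f x x'. D \<in> \<D> c \<Longrightarrow> f \<in> F \<Longrightarrow> x \<in> D \<Longrightarrow> x' \<in> D \<Longrightarrow> \<bar>f x - f x'\<bar> \<le> \<delta>"
    "\<And>x. x \<in> topspace X \<Longrightarrow> card {c \<in> {..<R}. x \<notin> \<Union>(\<D> c)} \<le> n"
proof -
  \<comment> \<open>Between consecutive integers of the scaled value, f varies by less than
    \<delta>. Grid values must be left out to keep the cells open; as t and t + 1/2 are never both
    integers, one of the two positions always works, and \<tau> records which functions use the
    shift.\<close>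
  define z where "z b f x = f x / \<delta> + (if b then 1/2 else 0)" for b and f :: "'a \<Rightarrow> real" and x
  have cz: "continuous_map X euclideanreal (z b f)" if "f \<in> F" for b f
    unfolding z_def by (intro continuous_intros F that) (use \<open>0 < \<delta>\<close> in auto)
  define A where "A \<tau> = {x \<in> topspace X. \<forall>f\<in>F. z (f \<in> \<tau>) f x \<notin> \<int>}" for \<tau>
  have foA: "functionally_open X (A \<tau>)" for \<tau>
    unfolding A_def
  proof (rule functionally_open_finite_All[OF F(1)])
    fix f assume f: "f \<in> F"
    \<comment> \<open>\<open>sin (pi * t)\<close> vanishes exactly at the integers, which makes
      avoiding the grid a cozero condition.\<close>
    have "continuous_map X euclideanreal (sin \<circ> (\<lambda>x. pi * z (f \<in> \<tau>) f x))"
      by (intro continuous_map_compose[of _ euclideanreal] continuous_intros cz f)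
         (auto intro: continuous_intros)
    then have "functionally_open X {x \<in> topspace X. sin (pi * z (f \<in> \<tau>) f x) \<noteq> 0}"
      unfolding functionally_open_def by (auto simp: o_def)
    moreover have "sin (pi * t) \<noteq> 0 \<longleftrightarrow> t \<notin> \<int>" for t :: real
      by (auto simp: sin_zero_iff_int2 Ints_def)
    ultimately show "functionally_open X {x \<in> topspace X. z (f \<in> \<tau>) f x \<notin> \<int>}" by simp
  qed
  have Acover: "(\<Union>\<tau>\<in>Pow F. A \<tau>) = topspace X"
  proof -
    have "x \<in> A {f \<in> F. z False f x \<in> \<int>}" if "x \<in> topspace X" for x
    proof -
      have "z True f x \<notin> \<int>" if "z False f x \<in> \<int>" for f
      proof
        assume "z True f x \<in> \<int>"
        then have "z True f x - z False f x \<in> \<int>" using that by (rule Ints_diff)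
        then show False using fraction_not_in_Ints[of 2 1, where 'a = real] by (simp add: z_def)
      qed
      then have "z (z False f x \<in> \<int>) f x \<notin> \<int>" for f
        by (cases "z False f x \<in> \<int>") simp_all
      then show ?thesis using that by (auto simp: A_def)
    qed
    then have "topspace X \<subseteq> (\<Union>\<tau>\<in>Pow F. A \<tau>)"
      by (intro subsetI UN_I[of "{f \<in> F. z False f _ \<in> \<int>}"]) auto
    moreover have "(\<Union>\<tau>\<in>Pow F. A \<tau>) \<subseteq> topspace X" by (auto simp: A_def)
    ultimately show ?thesis by blast
  qed
  obtain \<V> where \<V>: "finite_functionally_open_cover X \<V>" "\<And>V. V \<in> \<V> \<Longrightarrow> \<exists>\<tau>\<in>Pow F. V \<subseteq> A \<tau>"
    "\<And>x. x \<in> topspace X \<Longrightarrow> card {V \<in> \<V>. x \<in> V} \<le> n + 1"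
    by (rule functionally_open_cover_refine[OF dim _ foA Acover]) (use F in auto)
  then have fin: "finite \<V>" and fo: "\<And>V. V \<in> \<V> \<Longrightarrow> functionally_open X V" and cov: "\<Union>\<V> = topspace X"
    by (auto simp: finite_functionally_open_cover_def)
  obtain \<tau> where \<tau>: "\<And>V. V \<in> \<V> \<Longrightarrow> V \<subseteq> A (\<tau> V)"
    using \<V>(2) by metis
  obtain \<phi> where \<phi>: "\<And>V. V \<in> \<V> \<Longrightarrow> continuous_map X euclideanreal (\<phi> V)"
    "\<And>V. V \<in> \<V> \<Longrightarrow> V = {x \<in> topspace X. 0 < \<phi> V x}"
    "\<And>x. x \<in> topspace X \<Longrightarrow> \<exists>V\<in>\<V>. \<phi> V x = 1"
    "\<And>V x. V \<in> \<V> \<Longrightarrow> x \<in> topspace X \<Longrightarrow> 0 \<le> \<phi> V x \<and> \<phi> V x \<le> (1::real)"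
    using functionally_open_cover_normalise[of \<V> X "\<lambda>V. V"] fin fo cov by auto
  have mem: "x \<in> V \<longleftrightarrow> 0 < \<phi> V x" if "V \<in> \<V>" "x \<in> topspace X" for V x
    using \<phi>(2)[OF that(1)] that(2) by blast
  define \<theta> where "\<theta> c = 1 / (real c + 2)" for c :: nat
  have \<theta>: "0 < \<theta> c" "\<theta> c < 1" for c by (auto simp: \<theta>_def)
  have inj\<theta>: "inj \<theta>" by (auto simp: inj_def \<theta>_def)
  \<comment> \<open>One fixed member of S supplies the shift pattern, so that all cells with the
    same S share one grid.\<close>
  define p where "p S = (SOME V. V \<in> S)" for S :: "'a set set"
  have p: "p S \<in> S" if "S \<noteq> {}" for S
    unfolding p_def using that by (simp add: some_in_eq)
  define I where "I = (Pow \<V> - {{}}) \<times> (F \<rightarrow>\<^sub>E (UNIV::int set))"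
  have cI: "countable I"
    unfolding I_def using fin F(1) by (intro countable_SIGMA countable_PiE) (auto simp: countable_finite)
  define B where "B c i = {x \<in> topspace X. ((\<forall>V\<in>fst i. \<theta> c < \<phi> V x) \<and> (\<forall>V\<in>\<V> - fst i. \<phi> V x < \<theta> c)) \<and>
      (\<forall>f\<in>F. real_of_int (snd i f) < z (f \<in> \<tau> (p (fst i))) f x \<and>
              z (f \<in> \<tau> (p (fst i))) f x < real_of_int (snd i f) + 1)}" for c i
  have B1: "\<theta> c < \<phi> V x" if "x \<in> B c i" "V \<in> fst i" for c i x V
    using that unfolding B_def by blast
  have B2: "\<phi> V x < \<theta> c" if "x \<in> B c i" "V \<in> \<V>" "V \<notin> fst i" for c i x V
    using that unfolding B_def by blast
  have B3: "real_of_int (snd i f) < z (f \<in> \<tau> (p (fst i))) f x \<and>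
      z (f \<in> \<tau> (p (fst i))) f x < real_of_int (snd i f) + 1" if "x \<in> B c i" "f \<in> F" for c i x f
    using that unfolding B_def by blast
  define \<D> where "\<D> c = B c ` I" for c
  show ?thesis
  proof (rule that[of \<D>])
    show "countable (\<D> c)" for c
      using cI by (simp add: \<D>_def)
    \<comment> \<open>All inequalities defining a cell are strict: S consists of the members above
      the threshold, and S fixes the grid, in which x lies in only one open interval for each
      f.\<close>
    have uniq: "i = i'" if "i \<in> I" "i' \<in> I" "x \<in> B c i" "x \<in> B c i'" for c i i' x
    proof -
      have *: "fst j = {V \<in> \<V>. \<theta> c < \<phi> V x}" if "j \<in> I" "x \<in> B c j" for j
      proof -
        have sub: "fst j \<subseteq> \<V>" using that(1) by (auto simp: I_def)
        have "\<theta> c < \<phi> V x \<longleftrightarrow> V \<in> fst j" if "V \<in> \<V>" for V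
          using B1[OF \<open>x \<in> B c j\<close>, of V] B2[OF \<open>x \<in> B c j\<close>, of V] that
          by (cases "V \<in> fst j") auto
        then show ?thesis using sub by blast
      qed
      have 1: "fst i = fst i'" using *[of i] *[of i'] that by simp
      have "snd i f = snd i' f" for f
      proof (cases "f \<in> F")
        case True
        then have "real_of_int (snd i f) < real_of_int (snd i' f) + 1" "real_of_int (snd i' f) < real_of_int (snd i f) + 1"
          using B3[OF that(3) True] B3[OF that(4) True] unfolding 1 by linarith+
        then show ?thesis by linarith
      next
        case False
        then show ?thesis using that(1,2) by (auto simp: I_def PiE_def extensional_def)
      qed
      then show ?thesis using 1 by (auto simp: prod_eq_iff)
    qed
    then show "disjoint (\<D> c)" for c
      unfolding \<D>_def disjoint_def by blast
    show "functionally_open X D" if "D \<in> \<D> c" for c D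
    proof -
      obtain i where i: "i \<in> I" "D = B c i" using \<open>D \<in> \<D> c\<close> by (auto simp: \<D>_def)
      have sub: "fst i \<subseteq> \<V>" using i by (auto simp: I_def)
      show ?thesis
        unfolding i(2) B_def
        by (intro functionally_open_conj functionally_open_finite_All functionally_open_less F(1) \<phi>(1) cz)
           (use sub fin in \<open>auto intro: finite_subset intro!: continuous_intros cz\<close>)
    qed
    show "\<bar>f x - f x'\<bar> \<le> \<delta>" if D: "D \<in> \<D> c" and that: "f \<in> F" "x \<in> D" "x' \<in> D" for c D f x x'
    proof -
      obtain i where i: "i \<in> I" "D = B c i" using D by (auto simp: \<D>_def)
      define b where "b = (f \<in> \<tau> (p (fst i)))"
      have "real_of_int (snd i f) < z b f x" "z b f x < real_of_int (snd i f) + 1"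
        "real_of_int (snd i f) < z b f x'" "z b f x' < real_of_int (snd i f) + 1"
        using B3[of _ c i f] that i unfolding b_def by auto
      then have "\<bar>z b f x - z b f x'\<bar> \<le> 1" by linarith
      moreover have "z b f x - z b f x' = (f x - f x') / \<delta>" by (simp add: z_def diff_divide_distrib)
      ultimately show ?thesis using \<open>0 < \<delta>\<close> by (simp add: abs_divide)
    qed
    show "card {c \<in> {..<R}. x \<notin> \<Union>(\<D> c)} \<le> n" if x: "x \<in> topspace X" for x
    proof -
      \<comment> \<open>Unless the threshold is hit, x lies in the cell given by the set S of
        members above it: S is nonempty since some value is 1, and membership of x in
        \<open>p S\<close> makes the shifted values non-integral.\<close>
      have hit: "\<exists>V\<in>\<V>. \<phi> V x = \<theta> c" if "x \<notin> \<Union>(\<D> c)" for c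
      proof (rule ccontr)
        assume no: "\<not> ?thesis"
        define S where "S = {V \<in> \<V>. \<theta> c < \<phi> V x}"
        obtain V where "V \<in> \<V>" "\<phi> V x = 1" using \<phi>(3)[OF x] by auto
        then have "V \<in> S" using \<theta> by (auto simp: S_def)
        then have pS: "p S \<in> S" using p by auto
        then have "p S \<in> \<V>" "0 < \<phi> (p S) x" using \<theta>(1)[of c] by (auto simp: S_def)
        then have "x \<in> p S" using mem x by blast
        then have "x \<in> A (\<tau> (p S))" using \<tau> \<open>p S \<in> \<V>\<close> by blast
        then have nz: "z (f \<in> \<tau> (p S)) f x \<notin> \<int>" if "f \<in> F" for f
          using that by (auto simp: A_def)
        define \<kappa> where "\<kappa> = (\<lambda>f\<in>F. \<lfloor>z (f \<in> \<tau> (p S)) f x\<rfloor>)"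
        have "(S, \<kappa>) \<in> I"
          using \<open>V \<in> S\<close> by (auto simp: I_def S_def \<kappa>_def)
        moreover have "x \<in> B c (S, \<kappa>)"
          unfolding B_def
        proof (intro CollectI conjI ballI)
          fix V assume "V \<in> \<V> - fst (S, \<kappa>)"
          then show "\<phi> V x < \<theta> c" using no by (force simp: S_def)
        next
          fix f assume f: "f \<in> F"
          show "real_of_int (snd (S, \<kappa>) f) < z (f \<in> \<tau> (p (fst (S, \<kappa>)))) f x"
            using nz[OF f] f by (simp add: \<kappa>_def less_le) (metis Ints_of_int)
          show "z (f \<in> \<tau> (p (fst (S, \<kappa>)))) f x < real_of_int (snd (S, \<kappa>) f) + 1"
            using f by (simp add: \<kappa>_def)
        qed (use x in \<open>auto simp: S_def\<close>)
        ultimately show False using that by (auto simp: \<D>_def)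
      qed
      obtain V1 where V1: "V1 \<in> \<V>" "\<phi> V1 x = 1" using \<phi>(3)[OF x] by auto
      have sub: "{c \<in> {..<R}. x \<notin> \<Union>(\<D> c)} \<subseteq> the_inv \<theta> ` (\<lambda>V. \<phi> V x) ` ({V \<in> \<V>. x \<in> V} - {V1})"
      proof
        fix c assume "c \<in> {c \<in> {..<R}. x \<notin> \<Union>(\<D> c)}"
        then have "x \<notin> \<Union>(\<D> c)" by simp
        from hit[OF this] obtain V where V: "V \<in> \<V>" "\<phi> V x = \<theta> c" by blast
        have "x \<in> V" using mem[OF V(1) x] V(2) \<theta>(1)[of c] by simp
        moreover have "V \<noteq> V1" using V V1 \<theta>(2)[of c] by auto
        moreover have "c = the_inv \<theta> (\<phi> V x)" using V inj\<theta> by (simp add: the_inv_f_f)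
        ultimately show "c \<in> the_inv \<theta> ` (\<lambda>V. \<phi> V x) ` ({V \<in> \<V>. x \<in> V} - {V1})" using V by blast
      qed
      have "x \<in> V1" using mem[OF V1(1) x] V1 by simp
      then have "card ({V \<in> \<V>. x \<in> V} - {V1}) \<le> n" using \<V>(3)[OF x] V1 fin by simp
      moreover have "card {c \<in> {..<R}. x \<notin> \<Union>(\<D> c)} \<le> card ({V \<in> \<V>. x \<in> V} - {V1})"
      proof -
        have f: "finite ({V \<in> \<V>. x \<in> V} - {V1})" using fin by simp
        show ?thesis
          using card_mono[OF finite_imageI[OF finite_imageI[OF f]] sub]
            card_image_le[OF finite_imageI[OF f, of "\<lambda>V. \<phi> V x"], of "the_inv \<theta>"]
            card_image_le[OF f, of "\<lambda>V. \<phi> V x"] by linarith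
      qed
      ultimately show ?thesis by linarith
    qed
  qed
qed

text \<open>A countable set E of functions on X yields only countably many test functions, but enough of
  them to give points that are separated by E disjoint cozero neighbourhoods. All conditions imposed on
  a point of Y are expressed by test functions, which keeps the resulting subsets of Y zero sets even
  though neither X nor Y is assumed to be normal.\<close>

definition test_functions :: "'a topology \<Rightarrow> ('a \<Rightarrow> real) set \<Rightarrow> ('a \<Rightarrow> real) set" where
  "test_functions X E =
     {\<lambda>x\<in>topspace X. min 1 (real N * (\<Prod>(a, b, e)\<in>K. max 0 (a * e x + b))) | N K.
        finite K \<and> K \<subseteq> \<rat> \<times> \<rat> \<times> E}"

definition disjoint_functions :: "'a topology \<Rightarrow> ('a \<Rightarrow> real) set \<Rightarrow> bool" where
  "disjoint_functions X G \<longleftrightarrow>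
     (\<forall>e\<in>G. \<forall>e'\<in>G. e \<noteq> e' \<longrightarrow> (\<forall>x\<in>topspace X. e x = 0 \<or> e' x = 0))"

definition separated_by :: "('a \<Rightarrow> real) set \<Rightarrow> 'a set \<Rightarrow> bool" where
  "separated_by E S \<longleftrightarrow> (\<forall>x\<in>S. \<forall>x'\<in>S. x \<noteq> x' \<longrightarrow> (\<exists>e\<in>E. e x \<noteq> e x'))"

lemma countable_test_functions:
  assumes "countable E"
  shows "countable (test_functions X E)"
proof -
  let ?f = "\<lambda>(N::nat, K). \<lambda>x\<in>topspace X. min 1 (real N * (\<Prod>(a, b, e)\<in>K. max 0 (a * e x + b)))"
  have "countable ((\<rat>::real set) \<times> (\<rat>::real set) \<times> E)"
    by (intro countable_SIGMA countable_rat assms)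
  then have "countable ((UNIV::nat set) \<times> {K. finite K \<and> K \<subseteq> (\<rat>::real set) \<times> (\<rat>::real set) \<times> E})"
    by (rule countable_SIGMA[OF countableI_type countable_Collect_finite_subset])
  moreover have "test_functions X E \<subseteq> ?f ` (UNIV \<times> {K. finite K \<and> K \<subseteq> \<rat> \<times> \<rat> \<times> E})"
    by (force simp: test_functions_def)
  ultimately show ?thesis by (meson countable_image countable_subset)
qed

lemma test_functions_mono: "E \<subseteq> E' \<Longrightarrow> test_functions X E \<subseteq> test_functions X E'"
  unfolding test_functions_def by blast

lemma test_function_bounds:
  assumes "t \<in> test_functions X E" "x \<in> topspace X"
  shows "0 \<le> t x" "t x \<le> 1"
  using assms unfolding test_functions_def
  by (auto intro!: mult_nonneg_nonneg prod_nonneg)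

lemma test_function_in_Cb_space:
  assumes "t \<in> test_functions X E" "\<And>e. e \<in> E \<Longrightarrow> continuous_map X euclideanreal e"
  shows "t \<in> Cb_space X"
proof -
  obtain N K where t: "t = (\<lambda>x\<in>topspace X. min 1 (real N * (\<Prod>(a, b, e)\<in>K. max 0 (a * e x + b))))"
    and K: "finite K" "K \<subseteq> \<rat> \<times> \<rat> \<times> E"
    using assms(1) unfolding test_functions_def by auto
  have "continuous_map X euclideanreal (\<lambda>x. min 1 (real N * (\<Prod>k\<in>K. max 0 (fst k * (snd (snd k)) x + fst (snd k)))))"
    by (intro continuous_intros K assms(2)) (use K in auto)
  then have "continuous_map X euclideanreal t"
    by (rule continuous_map_eq) (simp add: t case_prod_unfold)
  then have "restrict t (topspace X) \<in> Cb_space X"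
    by (rule restrict_in_Cb_space[where b = 1]) (use test_function_bounds[OF assms(1)] in auto)
  then show ?thesis by (simp add: t restrict_def cong: if_cong)
qed

lemma test_function_cong:
  assumes "t \<in> test_functions X E" "x \<in> topspace X" "x' \<in> topspace X" "\<And>e. e \<in> E \<Longrightarrow> e x = e x'"
  shows "t x = t x'"
proof -
  obtain N K where t: "t = (\<lambda>x\<in>topspace X. min 1 (real N * (\<Prod>(a, b, e)\<in>K. max 0 (a * e x + b))))"
    and K: "finite K" "K \<subseteq> \<rat> \<times> \<rat> \<times> E"
    using assms(1) unfolding test_functions_def by auto
  have "(\<Prod>(a, b, e)\<in>K. max 0 (a * e x + b)) = (\<Prod>(a, b, e)\<in>K. max 0 (a * e x' + b))"
  proof (rule prod.cong[OF refl])
    fix k assume "k \<in> K"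
    then have "snd (snd k) \<in> E" using K(2) by auto
    then show "(case k of (a, b, e) \<Rightarrow> max 0 (a * e x + b)) = (case k of (a, b, e) \<Rightarrow> max 0 (a * e x' + b))"
      using assms(4)[of "snd (snd k)"] by (simp add: case_prod_unfold)
  qed
  then show ?thesis using assms(2,3) by (simp add: t)
qed

text \<open>Two different values of some e in E leave room for a rational number between them, so
  rational coefficients suffice. The sets \<open>\<Psi> x\<close> confine the carrier of
  \<open>t x\<close> to prescribed cozero sets; they are empty when only disjointness
  matters.\<close>

lemma separating_test_functions:
  assumes "finite S" "S \<subseteq> topspace X" "separated_by E S"
    and \<Psi>: "\<And>x. x \<in> S \<Longrightarrow> finite (\<Psi> x)" "\<And>x. x \<in> S \<Longrightarrow> \<Psi> x \<subseteq> E" "\<And>x e. x \<in> S \<Longrightarrow> e \<in> \<Psi> x \<Longrightarrow> 0 < e x"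
  obtains t where "\<And>x. x \<in> S \<Longrightarrow> t x \<in> test_functions X E" "\<And>x. x \<in> S \<Longrightarrow> t x x = (1::real)"
    "\<And>x x' u. x \<in> S \<Longrightarrow> x' \<in> S \<Longrightarrow> x \<noteq> x' \<Longrightarrow> u \<in> topspace X \<Longrightarrow> t x u = 0 \<or> t x' u = 0"
    "\<And>x e u. x \<in> S \<Longrightarrow> e \<in> \<Psi> x \<Longrightarrow> u \<in> topspace X \<Longrightarrow> t x u \<noteq> 0 \<Longrightarrow> 0 < e u"
proof -
  have "\<exists>a b e. a \<in> \<rat> \<and> b \<in> \<rat> \<and> e \<in> E \<and> 0 < a * e x + b \<and> a * e x' + b < 0"
    if xx: "x \<in> S" "x' \<in> S" "x \<noteq> x'" for x x'
  proof -
    obtain e where e: "e \<in> E" "e x \<noteq> e x'" using assms(3) xx unfolding separated_by_def by blast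
    show ?thesis
    proof (cases "e x < e x'")
      case True
      obtain q where "q \<in> \<rat>" "e x < q" "q < e x'" using Rats_dense_in_real[OF True] by auto
      then show ?thesis using e by (intro exI[of _ "-1"] exI[of _ q] exI[of _ e]) auto
    next
      case False
      then have "e x' < e x" using e by simp
      then obtain q where "q \<in> \<rat>" "e x' < q" "q < e x" using Rats_dense_in_real by blast
      then show ?thesis using e by (intro exI[of _ 1] exI[of _ "-q"] exI[of _ e]) auto
    qed
  qed
  then obtain a b e where abe: "\<And>x x'. x \<in> S \<Longrightarrow> x' \<in> S \<Longrightarrow> x \<noteq> x' \<Longrightarrow>
      a x x' \<in> \<rat> \<and> b x x' \<in> \<rat> \<and> e x x' \<in> E \<and> 0 < a x x' * e x x' x + b x x' \<and> a x x' * e x x' x' + b x x' < 0"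
    by metis
  \<comment> \<open>For an ordered pair x, x' the chosen affine expression is a factor for x and its
    negative a factor for x', so at every u one of the two products vanishes. The last group of
    factors forces e > 0 wherever the product is nonzero.\<close>
  define K where "K x = (\<lambda>x'. (a x x', b x x', e x x')) ` (S - {x}) \<union>
      (\<lambda>x'. (- a x' x, - b x' x, e x' x)) ` (S - {x}) \<union> (\<lambda>e. (1, 0, e)) ` \<Psi> x" for x
  have finK: "finite (K x)" if "x \<in> S" for x
    using assms(1) \<Psi>(1)[OF that] by (simp add: K_def)
  have subK: "K x \<subseteq> \<rat> \<times> \<rat> \<times> E" if "x \<in> S" for x
    using abe \<Psi>(2)[OF that] that by (auto simp: K_def)
  define P where "P x u = (\<Prod>(a, b, e)\<in>K x. max 0 (a * e u + b))" for x u
  have pos: "0 < P x x" if "x \<in> S" for x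
    unfolding P_def
  proof (rule prod_pos)
    fix k assume "k \<in> K x"
    then show "0 < (case k of (a, b, e) \<Rightarrow> max 0 (a * e x + b))"
      using abe \<Psi>(3)[OF that] that by (fastforce simp: K_def less_max_iff_disj)
  qed
  have zero: "P x u = 0" if "x \<in> S" "(a, b, e) \<in> K x" "a * e u + b \<le> 0" for x u a b e
    unfolding P_def using that finK[OF that(1)]
    by (subst prod_zero_iff) (auto intro!: bexI[of _ "(a, b, e)"])
  have "\<exists>N. 1 \<le> real N * P x x" if "x \<in> S" for x
    using reals_Archimedean3[OF pos[OF that]] by (metis less_imp_le)
  then obtain N where N: "\<And>x. x \<in> S \<Longrightarrow> 1 \<le> real (N x) * P x x" by metis
  define t where "t x = (\<lambda>u\<in>topspace X. min 1 (real (N x) * P x u))" for x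
  show ?thesis
  proof (rule that[of t])
    show "t x \<in> test_functions X E" if "x \<in> S" for x
      using finK[OF that] subK[OF that] unfolding t_def P_def test_functions_def by blast
    show "t x x = 1" if "x \<in> S" for x
      using N[OF that] assms(2) that by (auto simp: t_def)
    show "t x u = 0 \<or> t x' u = 0" if "x \<in> S" "x' \<in> S" "x \<noteq> x'" "u \<in> topspace X" for x x' u
    proof -
      have "(a x x', b x x', e x x') \<in> K x" "(- a x x', - b x x', e x x') \<in> K x'"
        using that by (auto simp: K_def)
      then have "P x u = 0 \<or> P x' u = 0"
        using zero[OF that(1), of "a x x'" "b x x'" "e x x'" u] zero[OF that(2), of "- a x x'" "- b x x'" "e x x'" u]
        by fastforce
      then show ?thesis using that(4) by (auto simp: t_def)
    qed
    show "0 < f u" if "x \<in> S" "f \<in> \<Psi> x" "u \<in> topspace X" "t x u \<noteq> 0" for x f u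
    proof (rule ccontr)
      assume "\<not> 0 < f u"
      moreover have "(1, 0, f) \<in> K x" using that by (auto simp: K_def)
      ultimately have "P x u = 0" using zero[OF that(1), of 1 0 f u] by simp
      then show False using that by (simp add: t_def)
    qed
  qed
qed

text \<open>Atoms that E cannot distinguish are merged, and those whose total weight is 0 are dropped.\<close>

lemma reduced_representation:
  fixes \<alpha> :: "'a \<Rightarrow> real"
  assumes "finite S"
  obtains S' \<alpha>' where "S' \<subseteq> S" "\<And>x. x \<in> S' \<Longrightarrow> \<alpha>' x \<noteq> (0::real)" "separated_by E S'"
    "\<And>h. (\<And>x x'. x \<in> S \<Longrightarrow> x' \<in> S \<Longrightarrow> (\<And>e. e \<in> E \<Longrightarrow> e x = e x') \<Longrightarrow> h x = h x') \<Longrightarrow>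
       (\<Sum>x\<in>S. \<alpha> x * h x) = (\<Sum>x\<in>S'. \<alpha>' x * h x)"
proof -
  \<comment> \<open>Outside E the vector is set to 0, so that equality of vectors means agreement on
    E; the fibres of \<pi> are the classes to be merged.\<close>
  define \<pi> where "\<pi> x = (\<lambda>e. if e \<in> E then e x else (0::real))" for x :: 'a
  have \<pi>: "\<pi> x = \<pi> x' \<longleftrightarrow> (\<forall>e\<in>E. e x = e x')" for x x'
    by (auto simp: \<pi>_def fun_eq_iff)
  define w where "w p = (\<Sum>x\<in>{x\<in>S. \<pi> x = p}. \<alpha> x)" for p
  define P where "P = {p \<in> \<pi> ` S. w p \<noteq> 0}"
  define \<rho> where "\<rho> = inv_into S \<pi>"
  have \<rho>: "\<rho> p \<in> S" "\<pi> (\<rho> p) = p" if "p \<in> \<pi> ` S" for p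
    using that by (auto simp: \<rho>_def inv_into_into f_inv_into_f)
  have inj: "inj_on \<rho> P" by (rule inj_on_inverseI[of _ \<pi>]) (auto simp: P_def \<rho>)
  show ?thesis
  proof (rule that[of "\<rho> ` P" "\<lambda>x. w (\<pi> x)"])
    show "\<rho> ` P \<subseteq> S" using \<rho> by (auto simp: P_def)
    show "w (\<pi> x) \<noteq> 0" if "x \<in> \<rho> ` P" for x
      using that \<rho> by (auto simp: P_def)
    show "separated_by E (\<rho> ` P)"
      unfolding separated_by_def
    proof (intro ballI impI)
      fix x x' assume "x \<in> \<rho> ` P" "x' \<in> \<rho> ` P" "x \<noteq> x'"
      then have "\<pi> x \<noteq> \<pi> x'" using \<rho> by (auto simp: P_def)
      then show "\<exists>e\<in>E. e x \<noteq> e x'" using \<pi> by blast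
    qed
    fix h :: "'a \<Rightarrow> real"
    assume h: "\<And>x x'. x \<in> S \<Longrightarrow> x' \<in> S \<Longrightarrow> (\<And>e. e \<in> E \<Longrightarrow> e x = e x') \<Longrightarrow> h x = h x'"
    have "(\<Sum>x\<in>S. \<alpha> x * h x) = (\<Sum>p\<in>\<pi> ` S. \<Sum>x\<in>{x\<in>S. \<pi> x = p}. \<alpha> x * h x)"
      by (rule sum.image_gen[OF assms])
    also have "\<dots> = (\<Sum>p\<in>\<pi> ` S. w p * h (\<rho> p))"
    proof (rule sum.cong[OF refl])
      fix p assume p: "p \<in> \<pi> ` S"
      have "h x = h (\<rho> p)" if "x \<in> S" "\<pi> x = p" for x
        using that h[of x "\<rho> p"] \<rho>[OF p] \<pi>[of x "\<rho> p"] by auto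
      then show "(\<Sum>x\<in>{x\<in>S. \<pi> x = p}. \<alpha> x * h x) = w p * h (\<rho> p)"
        by (simp add: w_def sum_distrib_right)
    qed
    also have "\<dots> = (\<Sum>p\<in>P. w p * h (\<rho> p))"
      by (rule sum.mono_neutral_right) (use assms in \<open>auto simp: P_def\<close>)
    also have "\<dots> = (\<Sum>x\<in>\<rho> ` P. w (\<pi> x) * h x)"
      unfolding sum.reindex[OF inj] o_def by (rule sum.cong) (auto simp: P_def \<rho>)
    finally show "(\<Sum>x\<in>S. \<alpha> x * h x) = (\<Sum>x\<in>\<rho> ` P. w (\<pi> x) * h x)" .
  qed
qed

section \<open>Linear algebra of nearly constant functions\<close>

text \<open>Gaussian elimination: an equation whose coefficients all vanish is dropped, and
  otherwise a pivot \<open>i0\<close> removes one equation together with one unknown, so the surplus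
  of unknowns persists.\<close>

lemma homogeneous_system_nontrivial_solution:
  fixes h :: "'i \<Rightarrow> 'b \<Rightarrow> real"
  assumes "finite B" "finite I" "card B < card I"
  shows "\<exists>c. (\<exists>i\<in>I. c i \<noteq> 0) \<and> (\<forall>b\<in>B. (\<Sum>i\<in>I. c i * h i b) = 0)"
  using assms
proof (induction B arbitrary: I h rule: finite_induct)
  case empty
  then have "I \<noteq> {}" by auto
  then show ?case by (intro exI[of _ "\<lambda>_. 1"]) auto
next
  case (insert b B)
  show ?case
  proof (cases "\<forall>i\<in>I. h i b = 0")
    case True
    have "card B < card I" using insert by simp
    then obtain c where "\<exists>i\<in>I. c i \<noteq> 0" "\<forall>b\<in>B. (\<Sum>i\<in>I. c i * h i b) = 0"
      using insert.IH[OF insert.prems(1)] by blast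
    then show ?thesis using True by (intro exI[of _ c]) auto
  next
    case False
    then obtain i0 where i0: "i0 \<in> I" "h i0 b \<noteq> 0" by auto
    define I' where "I' = I - {i0}"
    have I': "finite I'" "card B < card I'" "i0 \<notin> I'" "I = insert i0 I'"
      using insert i0 by (auto simp: I'_def)
    \<comment> \<open>Subtracting multiples of the coefficients of the pivot makes equation b
      trivial; the coefficient of \<open>i0\<close> in \<open>c'\<close> compensates for the
      subtraction.\<close>
    define h' where "h' i b' = h i b' - h i b / h i0 b * h i0 b'" for i b'
    obtain c where c: "\<exists>i\<in>I'. c i \<noteq> 0" "\<And>b'. b' \<in> B \<Longrightarrow> (\<Sum>i\<in>I'. c i * h' i b') = 0"
      using insert.IH[OF I'(1,2), of h'] by blast
    define c' where "c' = c(i0 := - (\<Sum>i\<in>I'. c i * h i b / h i0 b))"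
    have eq: "(\<Sum>i\<in>I. c' i * h i b') = (\<Sum>i\<in>I'. c i * h' i b')" for b'
    proof -
      have "(\<Sum>i\<in>I'. c' i * h i b') = (\<Sum>i\<in>I'. c i * h i b')"
        using I'(3) by (intro sum.cong) (auto simp: c'_def)
      then have "(\<Sum>i\<in>I. c' i * h i b') = (\<Sum>i\<in>I'. c i * h i b') - (\<Sum>i\<in>I'. c i * h i b / h i0 b) * h i0 b'"
        using I' by (simp add: c'_def)
      also have "\<dots> = (\<Sum>i\<in>I'. c i * h' i b')"
        unfolding sum_distrib_right sum_subtractf[symmetric] h'_def
        by (rule sum.cong) (simp_all add: right_diff_distrib)
      finally show ?thesis .
    qed
    have "(\<Sum>i\<in>I'. c i * h' i b) = 0"
      using i0 by (simp add: h'_def)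
    then have "\<forall>b'\<in>insert b B. (\<Sum>i\<in>I. c' i * h i b') = 0" using c(2) eq by auto
    moreover have "\<exists>i\<in>I. c' i \<noteq> 0" using c(1) I'(3,4) by (force simp: c'_def)
    ultimately show ?thesis by blast
  qed
qed

text \<open>If every functional is nearly supported on the \<^term>\<open>card B\<close> sets of B, on which all the
  functions are nearly constant, then its matrix is close to one of rank at most \<^term>\<open>card B\<close> and
  cannot be an identity matrix of larger size.\<close>

lemma small_oscillation_rank_bound:
  fixes f :: "'i \<Rightarrow> 'a \<Rightarrow> real" and \<alpha> :: "'i \<Rightarrow> 'a \<Rightarrow> real"
  assumes "finite I" "finite B" "card B < card I" "0 \<le> r"
    and S: "\<And>i. i \<in> I \<Longrightarrow> finite (S i)" "\<And>i. i \<in> I \<Longrightarrow> card (S i) \<le> K" "\<And>i. i \<in> I \<Longrightarrow> S i \<subseteq> \<Union>B"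
    and \<alpha>: "\<And>i x. i \<in> I \<Longrightarrow> x \<in> S i \<Longrightarrow> \<bar>\<alpha> i x\<bar> \<le> r"
    and osc: "\<And>i D x x'. i \<in> I \<Longrightarrow> D \<in> B \<Longrightarrow> x \<in> D \<Longrightarrow> x' \<in> D \<Longrightarrow> \<bar>f i x - f i x'\<bar> \<le> \<delta>"
    and small: "real K * r * real (card I) * \<delta> < 1"
  shows "\<not> (\<forall>i\<in>I. \<forall>i'\<in>I. (\<Sum>x\<in>S i'. \<alpha> i' x * f i x) = (if i = i' then 1 else 0))"
proof
  assume id: "\<forall>i\<in>I. \<forall>i'\<in>I. (\<Sum>x\<in>S i'. \<alpha> i' x * f i x) = (if i = i' then 1 else 0)"
  define q where "q D = (SOME x. x \<in> D)" for D :: "'a set"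
  have q: "q D \<in> D" if "x \<in> D" for x D
    unfolding q_def using that by (rule someI)
  \<comment> \<open>There are fewer representatives than functions, so a nontrivial combination of
    the functions vanishes at all of them and is small on the whole union of B.\<close>
  obtain c where c: "\<exists>i\<in>I. c i \<noteq> 0" "\<And>D. D \<in> B \<Longrightarrow> (\<Sum>i\<in>I. c i * f i (q D)) = 0"
    using homogeneous_system_nontrivial_solution[OF assms(2,1,3), of "\<lambda>i D. f i (q D)"] by auto
  have "I \<noteq> {}" using c(1) by auto
  obtain i0 where i0: "i0 \<in> I" "\<And>i. i \<in> I \<Longrightarrow> \<bar>c i\<bar> \<le> \<bar>c i0\<bar>"
  proof -
    have "Max ((\<lambda>i. \<bar>c i\<bar>) ` I) \<in> (\<lambda>i. \<bar>c i\<bar>) ` I"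
      using assms(1) \<open>I \<noteq> {}\<close> by (intro Max_in) auto
    then obtain i0 where "i0 \<in> I" "\<bar>c i0\<bar> = Max ((\<lambda>i. \<bar>c i\<bar>) ` I)" by auto
    then show ?thesis using assms(1) that[of i0] by simp
  qed
  have c0: "0 < \<bar>c i0\<bar>" using c(1) i0 by fastforce
  have \<delta>: "0 \<le> \<delta>" if "x \<in> S i0" for x
    using S(3)[OF i0(1)] that osc[OF i0(1), of _ x x] by force
  have bound: "\<bar>\<Sum>i\<in>I. c i * f i x\<bar> \<le> real (card I) * (\<bar>c i0\<bar> * \<delta>)" if x: "x \<in> S i0" for x
  proof -
    obtain D where D: "D \<in> B" "x \<in> D" using S(3)[OF i0(1)] x by blast
    have "(\<Sum>i\<in>I. c i * f i x) = (\<Sum>i\<in>I. c i * (f i x - f i (q D)))"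
      using c(2)[OF D(1)] by (simp add: right_diff_distrib sum_subtractf)
    also have "\<bar>\<dots>\<bar> \<le> (\<Sum>i\<in>I. \<bar>c i * (f i x - f i (q D))\<bar>)" by (rule sum_abs)
    also have "\<dots> \<le> (\<Sum>i\<in>I. \<bar>c i0\<bar> * \<delta>)"
      unfolding abs_mult using i0(2) osc D q[OF D(2)] by (intro sum_mono mult_mono) auto
    finally show ?thesis by simp
  qed
  \<comment> \<open>The identity matrix makes the functional of \<open>i0\<close> return
    \<open>c i0\<close> itself. As \<open>c i0\<close> has the largest modulus, every error term is
    measured against it, and \<open>c i0\<close> comes out smaller than itself in modulus.\<close>
  have "c i0 = (\<Sum>i\<in>I. c i * (\<Sum>x\<in>S i0. \<alpha> i0 x * f i x))"
  proof -
    have "(\<Sum>i\<in>I. c i * (\<Sum>x\<in>S i0. \<alpha> i0 x * f i x)) = (\<Sum>i\<in>I. if i = i0 then c i0 else 0)"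
      using id i0(1) by (intro sum.cong) auto
    then show ?thesis using i0(1) assms(1) by simp
  qed
  also have "\<dots> = (\<Sum>x\<in>S i0. \<alpha> i0 x * (\<Sum>i\<in>I. c i * f i x))"
    unfolding sum_distrib_left by (subst sum.swap) (simp add: mult.left_commute)
  finally have eq: "c i0 = (\<Sum>x\<in>S i0. \<alpha> i0 x * (\<Sum>i\<in>I. c i * f i x))" .
  have "\<bar>c i0\<bar> \<le> (\<Sum>x\<in>S i0. \<bar>\<alpha> i0 x * (\<Sum>i\<in>I. c i * f i x)\<bar>)"
    unfolding eq by (rule sum_abs)
  also have "\<dots> \<le> (\<Sum>x\<in>S i0. r * (real (card I) * (\<bar>c i0\<bar> * \<delta>)))"
    unfolding abs_mult using \<alpha>[OF i0(1)] bound \<open>0 \<le> r\<close> by (intro sum_mono mult_mono) auto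
  \<comment> \<open>Replacing \<open>card (S i0)\<close> by K requires \<delta> \<ge> 0, which an
    atom provides; without atoms the diagonal entry 1 would be an empty sum.\<close>
  also have "\<dots> \<le> real K * (r * (real (card I) * (\<bar>c i0\<bar> * \<delta>)))"
  proof (cases "S i0 = {}")
    case True
    have False using bspec[OF bspec[OF id i0(1)] i0(1)] True by simp
    then show ?thesis ..
  next
    case False
    then have "0 \<le> \<delta>" using \<delta> by auto
    then show ?thesis
      using S(2)[OF i0(1)] \<open>0 \<le> r\<close> by (simp add: mult_right_mono)
  qed
  also have "\<dots> = (real K * r * real (card I) * \<delta>) * \<bar>c i0\<bar>" by simp
  also have "\<dots> < 1 * \<bar>c i0\<bar>" using small c0 by (rule mult_strict_right_mono)
  finally show False by simp
qed

text \<open>For nonnegative h, the product over all subsets A of size \<^term>\<open>Suc d\<close> of the means of h over A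
  is a continuous positive lower bound for the value that is (d + 1)-st in increasing order.\<close>

lemma closed_cover_swelling:
  fixes J :: "'i set" and H U :: "'i \<Rightarrow> 'a set"
  assumes J: "finite J" and U: "\<And>j. j \<in> J \<Longrightarrow> functionally_open Y (U j)"
    and H: "\<And>j. j \<in> J \<Longrightarrow> functionally_open Y (topspace Y - H j)" "\<And>j. j \<in> J \<Longrightarrow> H j \<subseteq> U j"
    and order: "\<And>y. y \<in> topspace Y \<Longrightarrow> card {j \<in> J. y \<in> H j} \<le> d"
  obtains V where "\<And>j. j \<in> J \<Longrightarrow> functionally_open Y (V j)" "\<And>j. j \<in> J \<Longrightarrow> H j \<inter> topspace Y \<subseteq> V j"
    "\<And>j. j \<in> J \<Longrightarrow> V j \<subseteq> U j" "\<And>y. y \<in> topspace Y \<Longrightarrow> card {j \<in> J. y \<in> V j} \<le> d"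
proof -
  have "\<forall>j\<in>J. \<exists>h. continuous_map Y euclideanreal h \<and> (\<forall>y. 0 \<le> h y \<and> h y \<le> 1) \<and>
      topspace Y - H j = {y \<in> topspace Y. 0 < h y}"
  proof
    fix j assume "j \<in> J"
    show "\<exists>h. continuous_map Y euclideanreal h \<and> (\<forall>y. 0 \<le> h y \<and> h y \<le> 1) \<and>
        topspace Y - H j = {y \<in> topspace Y. 0 < h y}"
      by (rule functionally_open_witness[OF H(1)[OF \<open>j \<in> J\<close>]]) blast
  qed
  then obtain h where h: "\<And>j. j \<in> J \<Longrightarrow> continuous_map Y euclideanreal (h j)"
    "\<And>j y. j \<in> J \<Longrightarrow> 0 \<le> h j y \<and> h j y \<le> (1::real)"
    "\<And>j. j \<in> J \<Longrightarrow> topspace Y - H j = {y \<in> topspace Y. 0 < h j y}"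
    by metis
  have h0: "y \<in> H j \<longleftrightarrow> h j y = 0" if "j \<in> J" "y \<in> topspace Y" for j y
    using h(3)[OF that(1)] h(2)[OF that(1), of y] that(2) by (auto simp: set_eq_iff less_le)
  define \<A> where "\<A> = {A. A \<subseteq> J \<and> card A = Suc d}"
  have fin\<A>: "finite \<A>" using J by (simp add: \<A>_def)
  define \<tau> where "\<tau> y = (\<Prod>A\<in>\<A>. (\<Sum>j\<in>A. h j y) / real (Suc d))" for y
  have finA: "finite A" "A \<subseteq> J" "card A = Suc d" if "A \<in> \<A>" for A
    using that J by (auto simp: \<A>_def intro: finite_subset)
  have c\<tau>: "continuous_map Y euclideanreal \<tau>"
    unfolding \<tau>_def by (intro continuous_intros fin\<A> h) (use finA in auto)
  have mean_bounds: "0 \<le> (\<Sum>j\<in>A. h j y) / real (Suc d)" "(\<Sum>j\<in>A. h j y) / real (Suc d) \<le> 1" if "A \<in> \<A>" for A y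
  proof -
    have "(\<Sum>j\<in>A. h j y) \<le> (\<Sum>j\<in>A. 1)" using h(2) finA(2)[OF that] by (intro sum_mono) blast
    then show "(\<Sum>j\<in>A. h j y) / real (Suc d) \<le> 1" using finA(3)[OF that] by simp
    show "0 \<le> (\<Sum>j\<in>A. h j y) / real (Suc d)"
      using h(2) finA(2)[OF that] by (intro divide_nonneg_nonneg sum_nonneg) auto
  qed
  have \<tau>_pos: "0 < \<tau> y" if y: "y \<in> topspace Y" for y
    unfolding \<tau>_def
  proof (rule prod_pos)
    fix A assume A: "A \<in> \<A>"
    have "\<not> A \<subseteq> {j \<in> J. y \<in> H j}"
      using card_mono[of "{j \<in> J. y \<in> H j}" A] order[OF y] finA(3)[OF A] J by auto
    then obtain j where j: "j \<in> A" "j \<in> J" "y \<notin> H j" using finA(2)[OF A] by blast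
    then have "0 < h j y" using h0[OF j(2) y] h(2)[OF j(2), of y] by simp
    then have "0 < (\<Sum>j\<in>A. h j y)"
      using h(2) finA[OF A] j(1) by (intro sum_pos2[of A j]) auto
    then show "0 < (\<Sum>j\<in>A. h j y) / real (Suc d)" by simp
  qed
  have \<tau>_le: "\<tau> y \<le> (\<Sum>j\<in>A. h j y) / real (Suc d)" if A: "A \<in> \<A>" for A y
  proof -
    have "(\<Prod>A\<in>\<A> - {A}. (\<Sum>j\<in>A. h j y) / real (Suc d)) \<le> 1"
      by (intro prod_le_1) (use mean_bounds in auto)
    then show ?thesis
      unfolding \<tau>_def prod.remove[OF fin\<A> A] using mean_bounds(1)[OF A] by (rule mult_left_le)
  qed
  define V where "V j = U j \<inter> {y \<in> topspace Y. h j y < \<tau> y}" for j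
  show ?thesis
  proof (rule that[of V])
    show "functionally_open Y (V j)" if "j \<in> J" for j
      unfolding V_def by (intro functionally_open_Int functionally_open_less U h c\<tau> that)
    show "H j \<inter> topspace Y \<subseteq> V j" if "j \<in> J" for j
      using H(2)[OF that] h0[OF that] \<tau>_pos by (auto simp: V_def)
    show "V j \<subseteq> U j" for j by (auto simp: V_def)
    show "card {j \<in> J. y \<in> V j} \<le> d" if y: "y \<in> topspace Y" for y
    proof (rule ccontr)
      assume "\<not> ?thesis"
      then have "Suc d \<le> card {j \<in> J. y \<in> V j}" by simp
      then obtain A where A: "A \<subseteq> {j \<in> J. y \<in> V j}" "card A = Suc d"
        using obtain_subset_with_card_n by metis
      then have A\<A>: "A \<in> \<A>" by (auto simp: \<A>_def)
      \<comment> \<open>All terms over A are below \<open>\<tau> y\<close>, hence so is their mean;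
        but this mean is a factor of \<open>\<tau> y\<close> whose cofactors are at most 1, and so
        bounds it from above.\<close>
      have "(\<Sum>j\<in>A. h j y) < (\<Sum>j\<in>A. \<tau> y)"
        using A finA(1)[OF A\<A>] by (intro sum_strict_mono) (auto simp: V_def)
      then have "(\<Sum>j\<in>A. h j y) < real (Suc d) * \<tau> y" using A(2) by simp
      moreover have "\<tau> y * real (Suc d) \<le> (\<Sum>j\<in>A. h j y)"
        using \<tau>_le[OF A\<A>, of y] by (simp add: pos_le_divide_eq)
      ultimately show False by (simp add: mult.commute)
    qed
  qed
qed

section \<open>Functionals with few atoms\<close>

text \<open>Continuity and linearity of T and the bound on supports in \<beta>X are condensed into
  \<open>finite_support\<close>, a statement about points of X. The inclusions
  \<open>Cb_space X \<subseteq> DX \<subseteq> C_space X\<close> and surjectivity onto the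
  continuous functions with values in [0, 1] hold for all four choices of the function
  spaces.\<close>

locale finitely_supported_surjection =
  fixes X :: "'a topology" and Y :: "'b topology" and DX :: "('a \<Rightarrow> real) set"
    and T :: "('a \<Rightarrow> real) \<Rightarrow> 'b \<Rightarrow> real" and m n :: nat
  assumes dim: "covering_dim_le X n"
    and Cb_subset: "Cb_space X \<subseteq> DX" and DX_subset: "DX \<subseteq> C_space X"
    and continuous_T: "\<And>f. f \<in> DX \<Longrightarrow> continuous_map Y euclideanreal (T f)"
    and onto: "\<And>g. continuous_map Y euclideanreal g \<Longrightarrow> (\<And>y. 0 \<le> g y \<and> g y \<le> 1) \<Longrightarrow>
      \<exists>f\<in>DX. \<forall>y\<in>topspace Y. T f y = g y"
    and finite_support: "\<And>y. y \<in> topspace Y \<Longrightarrow>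
      \<exists>S \<alpha>. finite S \<and> S \<subseteq> topspace X \<and> card S \<le> m \<and> (\<forall>f\<in>DX. T f y = (\<Sum>x\<in>S. \<alpha> x * f x))"
begin

text \<open>A certificate for at least k atoms, since disjoint carriers contain different atoms. It
  refers to values of T only, so each G gives a cozero condition on y.\<close>

definition nonvanishing :: "('a \<Rightarrow> real) set \<Rightarrow> nat \<Rightarrow> 'b \<Rightarrow> ('a \<Rightarrow> real) set \<Rightarrow> bool" where
  "nonvanishing E k y G \<longleftrightarrow> G \<subseteq> test_functions X E \<and> finite G \<and> card G = k \<and>
     disjoint_functions X G \<and> (\<forall>e\<in>G. T e y \<noteq> 0)"

text \<open>This is a zero set which approximates from outside, as closely as E allows, the set of points of Y
  whose functional has at most k atoms and norm at most r.\<close>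

definition stratum :: "('a \<Rightarrow> real) set \<Rightarrow> nat \<Rightarrow> real \<Rightarrow> 'b set" where
  "stratum E k r = {y \<in> topspace Y. (\<forall>e\<in>test_functions X E. \<bar>T e y\<bar> \<le> r) \<and>
     \<not> (\<exists>G. nonvanishing E (Suc k) y G)}"

text \<open>Required against E and its test functions only: after merging, the sum may differ from
  \<open>T f y\<close> for other f. No bound on the number of atoms is built in; it comes from the
  stratum that contains y.\<close>

definition represents :: "('a \<Rightarrow> real) set \<Rightarrow> 'b \<Rightarrow> 'a set \<Rightarrow> ('a \<Rightarrow> real) \<Rightarrow> bool" where
  "represents E y S \<alpha> \<longleftrightarrow> finite S \<and> S \<subseteq> topspace X \<and> separated_by E S \<and>
     (\<forall>x\<in>S. \<alpha> x \<noteq> 0) \<and> (\<forall>f\<in>E \<union> test_functions X E. T f y = (\<Sum>x\<in>S. \<alpha> x * f x))"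

lemma continuous_DX: "f \<in> DX \<Longrightarrow> continuous_map X euclideanreal f"
  using DX_subset by (auto simp: C_space_def)

lemma test_functions_DX: "E \<subseteq> DX \<Longrightarrow> test_functions X E \<subseteq> DX"
  using test_function_in_Cb_space continuous_DX Cb_subset by blast

lemma represents_exists:
  assumes "E \<subseteq> DX" "y \<in> topspace Y"
  shows "\<exists>S \<alpha>. represents E y S \<alpha>"
proof -
  obtain S \<alpha> where S: "finite S" "S \<subseteq> topspace X" "\<And>f. f \<in> DX \<Longrightarrow> T f y = (\<Sum>x\<in>S. \<alpha> x * f x)"
    using finite_support[OF assms(2)] by auto
  obtain S' \<alpha>' where S': "S' \<subseteq> S" "\<And>x. x \<in> S' \<Longrightarrow> \<alpha>' x \<noteq> 0" "separated_by E S'"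
    "\<And>h. (\<And>x x'. x \<in> S \<Longrightarrow> x' \<in> S \<Longrightarrow> (\<And>e. e \<in> E \<Longrightarrow> e x = e x') \<Longrightarrow> h x = h x') \<Longrightarrow>
       (\<Sum>x\<in>S. \<alpha> x * h x) = (\<Sum>x\<in>S'. \<alpha>' x * h x)"
    using reduced_representation[OF S(1), where \<alpha> = \<alpha> and E = E] by blast
  have "T f y = (\<Sum>x\<in>S'. \<alpha>' x * f x)" if f: "f \<in> E \<union> test_functions X E" for f
  proof -
    have "(\<Sum>x\<in>S. \<alpha> x * f x) = (\<Sum>x\<in>S'. \<alpha>' x * f x)"
    proof (rule S'(4))
      fix x x' assume xx: "x \<in> S" "x' \<in> S" "\<And>e. e \<in> E \<Longrightarrow> e x = e x'"
      from f show "f x = f x'"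
      proof
        assume "f \<in> test_functions X E"
        then show ?thesis by (rule test_function_cong) (use xx S(2) in auto)
      qed (rule xx(3))
    qed
    moreover have "f \<in> DX" using f assms(1) test_functions_DX by blast
    ultimately show ?thesis by (simp add: S(3))
  qed
  then have "represents E y S' \<alpha>'"
    using S(1,2) S'(1-3) by (auto simp: represents_def intro: finite_subset)
  then show ?thesis by blast
qed

text \<open>Each \<open>t x\<close> is 1 at its own atom and 0 at the other atoms, so T reads off
  the weight, which is nonzero.\<close>

lemma nonvanishing_image:
  assumes rep: "represents E y S \<alpha>" and "S' \<subseteq> S"
    and t: "\<And>x. x \<in> S \<Longrightarrow> t x \<in> test_functions X E" "\<And>x. x \<in> S \<Longrightarrow> t x x = (1::real)"
      "\<And>x x' u. x \<in> S \<Longrightarrow> x' \<in> S \<Longrightarrow> x \<noteq> x' \<Longrightarrow> u \<in> topspace X \<Longrightarrow> t x u = 0 \<or> t x' u = 0"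
  shows "inj_on t S" "\<And>x. x \<in> S \<Longrightarrow> T (t x) y = \<alpha> x" "nonvanishing E (card S') y (t ` S')"
proof -
  have fin: "finite S" and sub: "S \<subseteq> topspace X" and nz: "\<And>x. x \<in> S \<Longrightarrow> \<alpha> x \<noteq> 0"
    using rep by (auto simp: represents_def)
  have off: "t x x' = 0" if "x \<in> S" "x' \<in> S" "x \<noteq> x'" for x x'
    using t(3)[OF that, of x'] t(2)[OF that(2)] sub that by auto
  show inj: "inj_on t S"
    by (rule inj_onI) (metis off t(2) zero_neq_one)
  show val: "T (t x) y = \<alpha> x" if "x \<in> S" for x
  proof -
    have "T (t x) y = (\<Sum>x'\<in>S. \<alpha> x' * t x x')"
      using rep t(1)[OF that] by (auto simp: represents_def)
    also have "\<dots> = (\<Sum>x'\<in>S. if x' = x then \<alpha> x else 0)"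
      using off t(2) that by (intro sum.cong) auto
    finally show ?thesis using fin that by simp
  qed
  have "disjoint_functions X (t ` S')"
    unfolding disjoint_functions_def using t(3) \<open>S' \<subseteq> S\<close> by blast
  then show "nonvanishing E (card S') y (t ` S')"
    unfolding nonvanishing_def using \<open>S' \<subseteq> S\<close> t(1) nz fin inj val
    by (auto simp: card_image inj_on_subset intro: finite_subset)
qed

text \<open>The stratum is defined by values of T, but its bounds pass to every reduced
  representation: isolating test functions turn atoms into a nonvanishing family and weights into
  values \<open>T e y\<close>.\<close>

lemma stratum_weights:
  assumes rep: "represents E y S \<alpha>" and y: "y \<in> stratum E k r"
  shows "card S \<le> k" "\<And>x. x \<in> S \<Longrightarrow> \<bar>\<alpha> x\<bar> \<le> r"
proof -
  have fin: "finite S" and sub: "S \<subseteq> topspace X" and sep: "separated_by E S"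
    using rep by (auto simp: represents_def)
  obtain t where t: "\<And>x. x \<in> S \<Longrightarrow> t x \<in> test_functions X E" "\<And>x. x \<in> S \<Longrightarrow> t x x = (1::real)"
    "\<And>x x' u. x \<in> S \<Longrightarrow> x' \<in> S \<Longrightarrow> x \<noteq> x' \<Longrightarrow> u \<in> topspace X \<Longrightarrow> t x u = 0 \<or> t x' u = 0"
    by (rule separating_test_functions[OF fin sub sep, of "\<lambda>_. {}"]) auto
  show "card S \<le> k"
  proof (rule ccontr)
    assume "\<not> card S \<le> k"
    then obtain S' where "S' \<subseteq> S" "card S' = Suc k"
      by (metis not_less_eq_eq obtain_subset_with_card_n)
    have "nonvanishing E (card S') y (t ` S')"
      by (rule nonvanishing_image(3)[OF rep \<open>S' \<subseteq> S\<close>]) (fact t)+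
    then show False using y \<open>card S' = Suc k\<close> unfolding stratum_def by auto
  qed
  show "\<bar>\<alpha> x\<bar> \<le> r" if "x \<in> S" for x
  proof -
    have "T (t x) y = \<alpha> x"
      by (rule nonvanishing_image(2)[OF rep subset_refl]) (fact t that)+
    then show ?thesis using t(1)[OF that] y by (auto simp: stratum_def)
  qed
qed

text \<open>Each member of G needs an atom in its carrier, and disjointness makes the choice
  injective. If there are at most k atoms the choice is a bijection, so G localises all atoms at
  once.\<close>

lemma nonvanishing_atoms:
  assumes rep: "represents E y S \<alpha>" and G: "nonvanishing E k y G"
  shows "k \<le> card S" "\<And>e. e \<in> G \<Longrightarrow> \<exists>x\<in>S. e x \<noteq> 0"
    "\<And>x. card S \<le> k \<Longrightarrow> x \<in> S \<Longrightarrow> \<exists>e\<in>G. e x \<noteq> 0"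
proof -
  have fin: "finite S" and sub: "S \<subseteq> topspace X" using rep by (auto simp: represents_def)
  show ex: "\<exists>x\<in>S. e x \<noteq> 0" if "e \<in> G" for e
  proof (rule ccontr)
    assume "\<not> ?thesis"
    moreover have "T e y = (\<Sum>x\<in>S. \<alpha> x * e x)" "T e y \<noteq> 0"
      using rep G that by (auto simp: represents_def nonvanishing_def)
    ultimately show False by simp
  qed
  then obtain p where p: "\<And>e. e \<in> G \<Longrightarrow> p e \<in> S" "\<And>e. e \<in> G \<Longrightarrow> e (p e) \<noteq> 0" by metis
  have inj: "inj_on p G"
  proof (rule inj_onI, rule ccontr)
    fix e e' assume "e \<in> G" "e' \<in> G" "p e = p e'" "e \<noteq> e'"
    then show False using G p sub unfolding nonvanishing_def disjoint_functions_def by (metis subsetD)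
  qed
  have k: "card (p ` G) = k" using G inj by (simp add: card_image nonvanishing_def)
  have pS: "p ` G \<subseteq> S" using p by auto
  show "k \<le> card S" using card_mono[OF fin pS] k by simp
  show "\<exists>e\<in>G. e x \<noteq> 0" if "card S \<le> k" "x \<in> S" for x
  proof -
    have "p ` G = S" using that(1) k by (intro card_seteq[OF fin pS]) simp
    then show ?thesis using p that(2) by blast
  qed
qed

section \<open>Strata as zero sets of Y and their splitting into cells\<close>

lemma functionally_open_nonvanishing:
  assumes "E \<subseteq> DX" "finite G" "G \<subseteq> test_functions X E"
  shows "functionally_open Y {y \<in> topspace Y. \<forall>e\<in>G. T e y \<noteq> 0}"
  using assms test_functions_DX[OF assms(1)]
  by (intro functionally_open_finite_All functionally_open_neq continuous_T) auto

text \<open>Here countability of E pays off: leaving the stratum is witnessed by one test function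
  or by one finite family of them, and there are only countably many of either.\<close>

lemma functionally_open_complement_stratum:
  assumes "countable E" "E \<subseteq> DX"
  shows "functionally_open Y {y \<in> topspace Y. y \<notin> stratum E k r}"
proof -
  let ?\<G> = "{G. finite G \<and> G \<subseteq> test_functions X E} \<inter> {G. card G = Suc k \<and> disjoint_functions X G}"
  have ct: "countable (test_functions X E)" by (rule countable_test_functions[OF assms(1)])
  have "{y \<in> topspace Y. y \<notin> stratum E k r} =
      {y \<in> topspace Y. (\<exists>e\<in>test_functions X E. r < \<bar>T e y\<bar>) \<or> (\<exists>G\<in>?\<G>. \<forall>e\<in>G. T e y \<noteq> 0)}"
    unfolding stratum_def nonvanishing_def by (auto simp: not_le)
  moreover have "functionally_open Y {y \<in> topspace Y. (\<exists>e\<in>test_functions X E. r < \<bar>T e y\<bar>) \<or> (\<exists>G\<in>?\<G>. \<forall>e\<in>G. T e y \<noteq> 0)}"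
    using test_functions_DX[OF assms(2)] ct countable_Collect_finite_subset[OF ct]
    by (intro functionally_open_disj functionally_open_countable_Ex functionally_open_less
        functionally_open_nonvanishing[OF assms(2)] continuous_intros continuous_T) auto
  ultimately show ?thesis by simp
qed

lemma stratum_mono: "E \<subseteq> E' \<Longrightarrow> stratum E' k r \<subseteq> stratum E k r"
  using test_functions_mono[of E E' X] unfolding stratum_def nonvanishing_def by blast

text \<open>For each colour, a point with exactly K atoms is classified by the set of members of that family
  which contain its atoms. In such a cell no function h takes more than K of the M values chosen as
  thresholds, so one threshold is avoided by all h at once; comparing the h with it splits the cell
  into disjoint pieces, each of them contained in a member of the cover.\<close>

lemma stratum_cells:
  fixes J :: "'i set" and V :: "'i \<Rightarrow> 'b set"
  assumes J: "finite J" and V: "\<And>j. j \<in> J \<Longrightarrow> functionally_open Y (V j)" "(\<Union>j\<in>J. V j) = topspace Y"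
    and "K \<le> m" and "0 \<le> r"
  obtains E where "countable E" "E \<subseteq> DX"
    "\<And>E'. countable E' \<Longrightarrow> E \<subseteq> E' \<Longrightarrow> E' \<subseteq> DX \<Longrightarrow>
      \<exists>W. (\<forall>j\<in>J. functionally_open Y (W j) \<and> W j \<subseteq> V j) \<and>
        (\<forall>y\<in>stratum E' K r. card {j \<in> J. y \<in> W j} \<le> m * n + 1 \<and>
          ((\<exists>G. nonvanishing E' K y G) \<longrightarrow> (\<exists>j\<in>J. y \<in> W j)))"
proof -
  obtain h where h: "\<And>j. j \<in> J \<Longrightarrow> continuous_map Y euclideanreal (h j)"
    "\<And>j. j \<in> J \<Longrightarrow> V j = {y \<in> topspace Y. 0 < h j y}"
    "\<And>y. y \<in> topspace Y \<Longrightarrow> \<exists>j\<in>J. h j y = 1"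
    "\<And>j y. j \<in> J \<Longrightarrow> y \<in> topspace Y \<Longrightarrow> 0 \<le> h j y \<and> h j y \<le> (1::real)"
    by (rule functionally_open_cover_normalise[OF J V]) auto
  \<comment> \<open>Pigeonhole: within a cell each of the \<open>card J\<close> functions takes at
    most K of the threshold values, so one of \<open>card J * K + 1\<close> thresholds stays
    free.\<close>
  define M where "M = card J * K + 1"
  define \<theta> where "\<theta> i = (real i + 1) / (real M + 1)" for i
  have \<theta>: "0 < \<theta> i" "i < M \<Longrightarrow> \<theta> i < 1" for i
    by (auto simp: \<theta>_def)
  \<comment> \<open>Tents around \<theta> i whose radius 1 / (M + 1) is the spacing of the
    thresholds: each is 1 at its own threshold and 0 at the others, which produces the identity
    matrix for the rank bound.\<close>
  define b where "b i j y = max 0 (1 - \<bar>h j y - \<theta> i\<bar> * (real M + 1))" for i j y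
  have b_val: "b i j y = (if i = i' then 1 else 0)" if "h j y = \<theta> i'" for i i' j y
  proof (cases "i = i'")
    case False
    have "\<bar>h j y - \<theta> i\<bar> * (real M + 1) = \<bar>(h j y - \<theta> i) * (real M + 1)\<bar>"
      by (simp add: abs_mult)
    also have "(h j y - \<theta> i) * (real M + 1) = real i' - real i"
      unfolding that \<theta>_def by (simp add: diff_divide_distrib[symmetric])
    finally show ?thesis using False by (simp add: b_def)
  qed (simp add: b_def that)
  have "\<forall>i. \<forall>j\<in>J. \<exists>f\<in>DX. \<forall>y\<in>topspace Y. T f y = b i j y"
  proof (intro allI ballI)
    fix i j assume j: "j \<in> J"
    have "continuous_map Y euclideanreal (b i j)"
      unfolding b_def by (intro continuous_intros h j)
    then show "\<exists>f\<in>DX. \<forall>y\<in>topspace Y. T f y = b i j y"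
      by (rule onto) (auto simp: b_def)
  qed
  then obtain f where f: "\<And>i j. j \<in> J \<Longrightarrow> f i j \<in> DX"
    "\<And>i j y. j \<in> J \<Longrightarrow> y \<in> topspace Y \<Longrightarrow> T (f i j) y = b i j y"
    by metis
  define F where "F = (\<lambda>(i, j). f i j) ` ({..<M} \<times> J)"
  have finF: "finite F" using J by (simp add: F_def)
  have FDX: "F \<subseteq> DX" using f by (auto simp: F_def)
  \<comment> \<open>Chosen for the rank bound with up to M functions; the added 1 makes the
    inequality strict and covers the case that K or r is 0.\<close>
  define \<delta> where "\<delta> = 1 / (real K * r * real M + 1)"
  have "0 < real K * r * real M + 1" using \<open>0 \<le> r\<close> by (simp add: add_nonneg_pos)
  then have \<delta>: "0 < \<delta>" "real K * r * real M * \<delta> < 1" by (auto simp: \<delta>_def)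
  obtain \<D> where \<D>: "\<And>c. countable (\<D> c)" "\<And>c. disjoint (\<D> c)"
    "\<And>c D. D \<in> \<D> c \<Longrightarrow> functionally_open X D"
    "\<And>c D f x x'. D \<in> \<D> c \<Longrightarrow> f \<in> F \<Longrightarrow> x \<in> D \<Longrightarrow> x' \<in> D \<Longrightarrow> \<bar>f x - f x'\<bar> \<le> \<delta>"
    "\<And>x. x \<in> topspace X \<Longrightarrow> card {c \<in> {..<m * n + 1}. x \<notin> \<Union>(\<D> c)} \<le> n"
    using covering_dim_coloured_families[OF dim finF _ \<delta>(1), of "m * n + 1"] FDX continuous_DX by blast
  \<comment> \<open>E has to know the members of the families: a function with carrier D lets test
    functions be confined to D.\<close>
  have "\<exists>\<psi>. \<psi> \<in> DX \<and> D = {x \<in> topspace X. 0 < \<psi> x}" if "D \<in> (\<Union>c. \<D> c)" for D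
  proof -
    have "functionally_open X D" using that \<D>(3) by blast
    then obtain g where g: "continuous_map X euclideanreal g" "\<And>x. 0 \<le> g x" "\<And>x. g x \<le> (1::real)"
      "D = {x \<in> topspace X. 0 < g x}"
      by (rule functionally_open_witness) blast
    define \<psi> where "\<psi> = restrict g (topspace X)"
    have "\<psi> \<in> Cb_space X"
      unfolding \<psi>_def by (rule restrict_in_Cb_space[OF g(1), where b = 1]) (use g(2,3) in auto)
    then show ?thesis using Cb_subset g(4) by (intro exI[of _ \<psi>]) (auto simp: \<psi>_def)
  qed
  then obtain \<psi> where \<psi>: "\<And>D. D \<in> (\<Union>c. \<D> c) \<Longrightarrow> \<psi> D \<in> DX"
    "\<And>D. D \<in> (\<Union>c. \<D> c) \<Longrightarrow> D = {x \<in> topspace X. 0 < \<psi> D x}"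
    by metis
  show ?thesis
  proof (rule that[of "F \<union> \<psi> ` (\<Union>c. \<D> c)"])
    show "countable (F \<union> \<psi> ` (\<Union>c. \<D> c))"
      using finF \<D>(1) by (auto intro: countable_finite)
    show "F \<union> \<psi> ` (\<Union>c. \<D> c) \<subseteq> DX" using FDX \<psi>(1) by blast
    fix E assume E: "countable E" "F \<union> \<psi> ` (\<Union>c. \<D> c) \<subseteq> E" "E \<subseteq> DX"
    have FE: "F \<subseteq> E" using E(2) by blast
    have \<psi>E: "\<psi> D \<in> E" if "D \<in> \<D> c" for D c using E(2) that by blast
    have "\<forall>y\<in>topspace Y. \<exists>S \<alpha>. represents E y S \<alpha>"
      using represents_exists[OF E(3)] by blast
    then obtain S \<alpha> where rep: "\<And>y. y \<in> topspace Y \<Longrightarrow> represents E y (S y) (\<alpha> y)"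
      by metis
    have str_Y: "y \<in> topspace Y" if "y \<in> stratum E K r" for y
      using that by (simp add: stratum_def)
    have card_S: "card (S y) \<le> K" and abs_\<alpha>: "\<And>x. x \<in> S y \<Longrightarrow> \<bar>\<alpha> y x\<bar> \<le> r" if "y \<in> stratum E K r" for y
      using stratum_weights[OF rep[OF str_Y[OF that]] that] by blast+
    have S_X: "finite (S y)" "S y \<subseteq> topspace X" "separated_by E (S y)" if "y \<in> topspace Y" for y
      using rep[OF that] by (auto simp: represents_def)

    define cells where "cells c = {\<beta>. finite \<beta> \<and> \<beta> \<subseteq> \<D> c}" for c
    \<comment> \<open>The carriers of G lie inside members of \<beta>, and each member is used. So
      on the stratum, values of T alone can tell that the atoms lie in \<beta>.\<close>
    define adapted where "adapted \<beta> G \<longleftrightarrow> finite G \<and> G \<subseteq> test_functions X E \<and> card G = K \<and> disjoint_functions X G \<and>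
        (\<exists>d. d ` G = \<beta> \<and> (\<forall>e\<in>G. {x \<in> topspace X. e x \<noteq> 0} \<subseteq> d e))" for \<beta> G
    define Q where "Q \<beta> = {y \<in> topspace Y. \<exists>G\<in>Collect (adapted \<beta>). \<forall>e\<in>G. T e y \<noteq> 0}" for \<beta>
    have foQ: "functionally_open Y (Q \<beta>)" for \<beta>
      unfolding Q_def
    proof (rule functionally_open_countable_Ex)
      show "countable (Collect (adapted \<beta>))"
        by (rule countable_subset[OF _ countable_Collect_finite_subset[OF countable_test_functions[OF E(1), of X]]])
           (auto simp: adapted_def)
      show "functionally_open Y {y \<in> topspace Y. \<forall>e\<in>G. T e y \<noteq> 0}" if "G \<in> Collect (adapted \<beta>)" for G
        using functionally_open_nonvanishing[OF E(3)] that by (auto simp: adapted_def)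
    qed

    \<comment> \<open>On the stratum there are at most K atoms, so G catches them all. Disjointness
      within the colour c makes \<beta> exactly the set of members met by atoms, hence unique for y
      and c.\<close>
    have Q_cell: "S y \<subseteq> \<Union>\<beta> \<and> \<beta> = {D \<in> \<D> c. \<exists>x\<in>S y. x \<in> D} \<and> card \<beta> \<le> K"
      if y: "y \<in> stratum E K r" and "y \<in> Q \<beta>" and \<beta>: "\<beta> \<in> cells c" for y \<beta> c
    proof -
      obtain G where G: "adapted \<beta> G" "\<And>e. e \<in> G \<Longrightarrow> T e y \<noteq> 0"
        using \<open>y \<in> Q \<beta>\<close> by (auto simp: Q_def)
      then obtain d where d: "d ` G = \<beta>" "\<And>e x. e \<in> G \<Longrightarrow> x \<in> topspace X \<Longrightarrow> e x \<noteq> 0 \<Longrightarrow> x \<in> d e"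
        unfolding adapted_def by blast
      have nv: "nonvanishing E K y G" using G by (auto simp: adapted_def nonvanishing_def)
      note atoms = nonvanishing_atoms[OF rep[OF str_Y[OF y]] nv]
      have sub: "S y \<subseteq> topspace X" using S_X str_Y y by blast
      have 1: "\<exists>D\<in>\<beta>. x \<in> D" if "x \<in> S y" for x
      proof -
        obtain e where "e \<in> G" "e x \<noteq> 0" using atoms(3)[OF card_S[OF y] \<open>x \<in> S y\<close>] by blast
        then have "x \<in> d e" using d(2) sub \<open>x \<in> S y\<close> by blast
        then show ?thesis using d(1) \<open>e \<in> G\<close> by blast
      qed
      have 2: "\<exists>x\<in>S y. x \<in> D" if "D \<in> \<beta>" for D
      proof -
        obtain e where e: "e \<in> G" "D = d e" using d(1) \<open>D \<in> \<beta>\<close> by blast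
        then obtain x where "x \<in> S y" "e x \<noteq> 0" using atoms(2) by blast
        then show ?thesis using d(2) sub e by blast
      qed
      have \<beta>\<D>: "\<beta> \<subseteq> \<D> c" using \<beta> by (simp add: cells_def)
      have "D \<in> \<beta>" if D: "D \<in> \<D> c" "x \<in> S y" "x \<in> D" for D x
      proof -
        obtain D' where D': "D' \<in> \<beta>" "x \<in> D'" using 1[OF D(2)] by blast
        then have "D' = D" using \<D>(2)[of c] \<beta>\<D> D unfolding disjoint_def by blast
        then show ?thesis using D' by simp
      qed
      then have "D \<in> \<beta> \<longleftrightarrow> D \<in> \<D> c \<and> (\<exists>x\<in>S y. x \<in> D)" for D
        using 2[of D] subsetD[OF \<beta>\<D>, of D] by blast
      then have "\<beta> = {D \<in> \<D> c. \<exists>x\<in>S y. x \<in> D}" by (intro set_eqI) simp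
      moreover have "card \<beta> \<le> K"
      proof -
        have "finite G" "card G = K" using nv by (simp_all add: nonvanishing_def)
        then show ?thesis using card_image_le[of G d] unfolding d(1) by simp
      qed
      moreover have "S y \<subseteq> \<Union>\<beta>"
      proof
        fix x assume "x \<in> S y"
        from 1[OF this] show "x \<in> \<Union>\<beta>" by blast
      qed
      ultimately show ?thesis by (intro conjI)
    qed

    \<comment> \<open>A colour is unusable if some atom misses it. At most m atoms exclude at most m
      * n colours, which leaves one of the m * n + 1.\<close>
    have cell_exists: "\<exists>c<m * n + 1. \<exists>\<beta>\<in>cells c. y \<in> Q \<beta>"
      if y: "y \<in> stratum E K r" and nv: "nonvanishing E K y G" for y G
    proof -
      note yY = str_Y[OF y]
      have cS: "card (S y) = K"
        using card_S[OF y] nonvanishing_atoms(1)[OF rep[OF yY] nv] by simp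
      have "\<exists>c<m * n + 1. S y \<subseteq> \<Union>(\<D> c)"
      proof (rule ccontr)
        assume no: "\<not> ?thesis"
        have "{..<m * n + 1} \<subseteq> (\<Union>x\<in>S y. {c \<in> {..<m * n + 1}. x \<notin> \<Union>(\<D> c)})"
        proof
          fix c assume c: "c \<in> {..<m * n + 1}"
          then obtain x where "x \<in> S y" "x \<notin> \<Union>(\<D> c)" using no by blast
          then show "c \<in> (\<Union>x\<in>S y. {c \<in> {..<m * n + 1}. x \<notin> \<Union>(\<D> c)})" using c by blast
        qed
        then have "m * n + 1 \<le> card (\<Union>x\<in>S y. {c \<in> {..<m * n + 1}. x \<notin> \<Union>(\<D> c)})"
          using S_X(1)[OF yY] card_mono[of "\<Union>x\<in>S y. {c \<in> {..<m * n + 1}. x \<notin> \<Union>(\<D> c)}" "{..<m * n + 1}"] by simp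
        also have "\<dots> \<le> (\<Sum>x\<in>S y. card {c \<in> {..<m * n + 1}. x \<notin> \<Union>(\<D> c)})"
          by (rule card_UN_le[OF S_X(1)[OF yY]])
        also have "\<dots> \<le> (\<Sum>x\<in>S y. n)"
          using \<D>(5) S_X(2)[OF yY] by (intro sum_mono) blast
        also have "\<dots> \<le> m * n" using cS \<open>K \<le> m\<close> by simp
        finally show False by simp
      qed
      then obtain c where c: "c < m * n + 1" "S y \<subseteq> \<Union>(\<D> c)" by blast
      then have "\<forall>x\<in>S y. \<exists>D. D \<in> \<D> c \<and> x \<in> D" by blast
      then obtain d where d: "\<And>x. x \<in> S y \<Longrightarrow> d x \<in> \<D> c" "\<And>x. x \<in> S y \<Longrightarrow> x \<in> d x" by metis
      have d\<psi>: "u \<in> d x \<longleftrightarrow> 0 < \<psi> (d x) u" if "x \<in> S y" "u \<in> topspace X" for x u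
        using \<psi>(2)[of "d x"] d(1)[OF that(1)] that(2) by blast
      obtain t where t: "\<And>x. x \<in> S y \<Longrightarrow> t x \<in> test_functions X E" "\<And>x. x \<in> S y \<Longrightarrow> t x x = (1::real)"
        "\<And>x x' u. x \<in> S y \<Longrightarrow> x' \<in> S y \<Longrightarrow> x \<noteq> x' \<Longrightarrow> u \<in> topspace X \<Longrightarrow> t x u = 0 \<or> t x' u = 0"
        "\<And>x e u. x \<in> S y \<Longrightarrow> e \<in> {\<psi> (d x)} \<Longrightarrow> u \<in> topspace X \<Longrightarrow> t x u \<noteq> 0 \<Longrightarrow> 0 < e u"
      proof (rule separating_test_functions[OF S_X[OF yY], of "\<lambda>x. {\<psi> (d x)}"])
        show "{\<psi> (d x)} \<subseteq> E" if "x \<in> S y" for x using \<psi>E d(1) that by blast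
        show "0 < e x" if "x \<in> S y" "e \<in> {\<psi> (d x)}" for x e
          using d\<psi>[of x x] d(2) that S_X(2)[OF yY] by blast
      qed auto
      have inj: "inj_on t (S y)"
        by (rule nonvanishing_image(1)[OF rep[OF yY] subset_refl]) (fact t)+
      have "nonvanishing E (card (S y)) y (t ` S y)"
        by (rule nonvanishing_image(3)[OF rep[OF yY] subset_refl]) (fact t)+
      then have nv: "nonvanishing E K y (t ` S y)" using cS by simp
      have "adapted (d ` S y) (t ` S y)"
        unfolding adapted_def
      proof (intro conjI exI[of _ "d \<circ> the_inv_into (S y) t"])
        show "(d \<circ> the_inv_into (S y) t) ` t ` S y = d ` S y"
          by (simp add: image_image the_inv_into_f_f[OF inj] cong: image_cong_simp)
        show "\<forall>e\<in>t ` S y. {x \<in> topspace X. e x \<noteq> 0} \<subseteq> (d \<circ> the_inv_into (S y) t) e"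
          using t(4) d\<psi> by (auto simp: the_inv_into_f_f[OF inj])
      qed (use nv in \<open>auto simp: nonvanishing_def\<close>)
      then have "y \<in> Q (d ` S y)"
        using nv yY unfolding Q_def nonvanishing_def by blast
      moreover have "d ` S y \<in> cells c"
        using d(1) S_X(1)[OF yY] by (auto simp: cells_def)
      ultimately show ?thesis using c(1) by blast
    qed

    \<comment> \<open>More than K thresholds hit on one cell would give as many points whose
      functionals form an identity matrix against the preimages of the tents, although all of them
      are carried by the at most K sets of \<beta>.\<close>
    have hits: "card {i \<in> {..<M}. \<exists>y\<in>Q \<beta> \<inter> stratum E K r. h j y = \<theta> i} \<le> K"
      if \<beta>: "\<beta> \<in> cells c" and j: "j \<in> J" for c \<beta> j
    proof (rule ccontr)
      define I where "I = {i \<in> {..<M}. \<exists>y\<in>Q \<beta> \<inter> stratum E K r. h j y = \<theta> i}"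
      assume "\<not> card {i \<in> {..<M}. \<exists>y\<in>Q \<beta> \<inter> stratum E K r. h j y = \<theta> i} \<le> K"
      then have cI: "K < card I" by (simp add: I_def)
      have finI: "finite I" and IM: "I \<subseteq> {..<M}" by (auto simp: I_def)
      then have "card I \<le> M" using card_mono[of "{..<M}" I] by simp
      have "\<forall>i\<in>I. \<exists>y. y \<in> Q \<beta> \<and> y \<in> stratum E K r \<and> h j y = \<theta> i" by (auto simp: I_def)
      then obtain w where w: "\<And>i. i \<in> I \<Longrightarrow> w i \<in> Q \<beta>" "\<And>i. i \<in> I \<Longrightarrow> w i \<in> stratum E K r"
        "\<And>i. i \<in> I \<Longrightarrow> h j (w i) = \<theta> i"
        by metis
      obtain i where "i \<in> I" using cI by fastforce
      then have c\<beta>: "card \<beta> \<le> K" using Q_cell[OF w(2) w(1) \<beta>] by blast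
      have fin\<beta>: "finite \<beta>" and \<beta>\<D>: "\<beta> \<subseteq> \<D> c" using \<beta> by (auto simp: cells_def)
      have fF: "f i j \<in> F" if "i \<in> I" for i using that IM j by (auto simp: F_def)
      have "real K * r * real (card I) * \<delta> \<le> real K * r * real M * \<delta>"
        using \<open>0 \<le> r\<close> \<delta>(1) \<open>card I \<le> M\<close> by (intro mult_right_mono mult_left_mono) auto
      then have small: "real K * r * real (card I) * \<delta> < 1" using \<delta>(2) by linarith
      have "\<not> (\<forall>i\<in>I. \<forall>i'\<in>I. (\<Sum>x\<in>S (w i'). \<alpha> (w i') x * f i j x) = (if i = i' then 1 else 0))"
      proof (rule small_oscillation_rank_bound[OF finI fin\<beta> _ \<open>0 \<le> r\<close> _ _ _ _ _ small])
        show "card \<beta> < card I" using c\<beta> cI by simp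
        show "finite (S (w i))" if "i \<in> I" for i using S_X(1) str_Y w(2) that by blast
        show "card (S (w i)) \<le> K" if "i \<in> I" for i using card_S w(2) that by blast
        show "S (w i) \<subseteq> \<Union>\<beta>" if "i \<in> I" for i using Q_cell[OF w(2) w(1) \<beta>] that by blast
        show "\<bar>\<alpha> (w i) x\<bar> \<le> r" if "i \<in> I" "x \<in> S (w i)" for i x using abs_\<alpha> w(2) that by blast
        show "\<bar>f i j x - f i j x'\<bar> \<le> \<delta>" if "i \<in> I" "D \<in> \<beta>" "x \<in> D" "x' \<in> D" for i D x x'
          using \<D>(4) fF \<beta>\<D> that by blast
      qed
      moreover have "(\<Sum>x\<in>S (w i'). \<alpha> (w i') x * f i j x) = (if i = i' then 1 else 0)"
        if "i \<in> I" "i' \<in> I" for i i'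
      proof -
        have yY: "w i' \<in> topspace Y" using str_Y w(2) that(2) by blast
        have "f i j \<in> E" using fF[OF that(1)] FE by blast
        then have "T (f i j) (w i') = (\<Sum>x\<in>S (w i'). \<alpha> (w i') x * f i j x)"
          using rep[OF yY] by (simp add: represents_def)
        then show ?thesis using f(2)[OF j yY] b_val[OF w(3)[OF that(2)]] by simp
      qed
      ultimately show False by blast
    qed
    have "\<exists>s. 0 < s \<and> s < 1 \<and> (\<forall>y\<in>Q \<beta> \<inter> stratum E K r. \<forall>j\<in>J. h j y \<noteq> s)"
      if \<beta>: "\<beta> \<in> cells c" for \<beta> c
    proof -
      let ?I = "\<lambda>j. {i \<in> {..<M}. \<exists>y\<in>Q \<beta> \<inter> stratum E K r. h j y = \<theta> i}"
      have "card (\<Union>j\<in>J. ?I j) \<le> (\<Sum>j\<in>J. card (?I j))" by (rule card_UN_le[OF J])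
      also have "\<dots> \<le> (\<Sum>j\<in>J. K)" by (intro sum_mono hits[OF \<beta>])
      also have "\<dots> < card {..<M}" by (simp add: M_def)
      finally have "\<not> {..<M} \<subseteq> (\<Union>j\<in>J. ?I j)"
        using card_mono[of "\<Union>j\<in>J. ?I j" "{..<M}"] J by auto
      then obtain i where "i < M" "i \<notin> (\<Union>j\<in>J. ?I j)" by blast
      then show ?thesis using \<theta> by (intro exI[of _ "\<theta> i"]) auto
    qed
    then have "\<exists>s. \<beta> \<in> (\<Union>c. cells c) \<longrightarrow>
        0 < s \<and> s < 1 \<and> (\<forall>y\<in>Q \<beta> \<inter> stratum E K r. \<forall>j\<in>J. h j y \<noteq> s)" for \<beta>
      by blast
    then obtain s where "\<And>\<beta>. \<beta> \<in> (\<Union>c. cells c) \<longrightarrow>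
        0 < s \<beta> \<and> s \<beta> < 1 \<and> (\<forall>y\<in>Q \<beta> \<inter> stratum E K r. \<forall>j\<in>J. h j y \<noteq> s \<beta>)"
      by metis
    then have s: "0 < s \<beta>" "s \<beta> < 1" "\<And>y j. y \<in> Q \<beta> \<Longrightarrow> y \<in> stratum E K r \<Longrightarrow> j \<in> J \<Longrightarrow> h j y \<noteq> s \<beta>"
      if "\<beta> \<in> cells c" for \<beta> c
      using that by blast+

    define p where "p A = (SOME j. j \<in> A)" for A :: "'i set"
    have p: "p A \<in> A" if "A \<noteq> {}" for A
      unfolding p_def using that by (simp add: some_in_eq)
    \<comment> \<open>On the part of the cell in the stratum no \<open>h i\<close> takes the value
      \<open>s \<beta>\<close>, so strict inequalities determine the set A of functions above it;
      the piece is assigned to the index \<open>p A\<close>.\<close>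
    define sel where "sel \<beta> A y \<longleftrightarrow> (\<forall>i\<in>A. s \<beta> < h i y) \<and> (\<forall>i\<in>J - A. h i y < s \<beta>)" for \<beta> A y
    define W where "W j = {y \<in> topspace Y. \<exists>c\<in>{..<m * n + 1}. \<exists>\<beta>\<in>cells c. \<exists>A\<in>{A \<in> Pow J - {{}}. p A = j}. y \<in> Q \<beta> \<and> sel \<beta> A y}" for j
    have foW: "functionally_open Y (W j)" for j
      unfolding W_def
    proof (intro functionally_open_countable_Ex)
      show "countable (cells c)" for c
        unfolding cells_def by (rule countable_Collect_finite_subset[OF \<D>(1)])
      show "countable {A \<in> Pow J - {{}}. p A = j}" using J by (intro countable_finite) simp
      show "functionally_open Y {y \<in> topspace Y. y \<in> Q \<beta> \<and> sel \<beta> A y}"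
        if "A \<in> {A \<in> Pow J - {{}}. p A = j}" for \<beta> A
      proof -
        have A: "finite A" "A \<subseteq> J" using that J by (auto intro: finite_subset)
        have "Q \<beta> = {y \<in> topspace Y. y \<in> Q \<beta>}" by (auto simp: Q_def)
        then have "functionally_open Y {y \<in> topspace Y. y \<in> Q \<beta>}" using foQ by metis
        then show ?thesis
          unfolding sel_def using A J
          by (intro functionally_open_conj functionally_open_finite_All functionally_open_less h) auto
      qed
    qed auto
    have WV: "W j \<subseteq> V j" if j: "j \<in> J" for j
    proof
      fix y assume "y \<in> W j"
      then obtain c \<beta> A where *: "y \<in> topspace Y" "\<beta> \<in> cells c" "A \<noteq> {}" "p A = j" "sel \<beta> A y"
        unfolding W_def by blast
      then have "s \<beta> < h j y" using p[OF *(3)] by (auto simp: sel_def)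
      then show "y \<in> V j" using s(1)[OF *(2)] *(1) h(2)[OF j] by simp
    qed
    have order: "card {j \<in> J. y \<in> W j} \<le> m * n + 1" if y: "y \<in> stratum E K r" for y
    proof -
      define C where "C j c \<longleftrightarrow> (\<exists>\<beta>\<in>cells c. \<exists>A\<in>Pow J - {{}}. p A = j \<and> y \<in> Q \<beta> \<and> sel \<beta> A y)" for j c
      \<comment> \<open>At y a colour determines \<beta>, then A, then j, so each colour contributes
        at most one index.\<close>
      have uniq: "j = j'" if C: "C j c" "C j' c" for j j' c
      proof -
        obtain \<beta> A where 1: "\<beta> \<in> cells c" "A \<subseteq> J" "p A = j" "y \<in> Q \<beta>" "sel \<beta> A y"
          using C(1) unfolding C_def by blast
        obtain \<beta>' A' where 2: "\<beta>' \<in> cells c" "A' \<subseteq> J" "p A' = j'" "y \<in> Q \<beta>'" "sel \<beta>' A' y"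
          using C(2) unfolding C_def by blast
        have \<beta>: "\<beta> = \<beta>'" using Q_cell[OF y 1(4,1)] Q_cell[OF y 2(4,1)] by simp
        have "i \<in> A \<longleftrightarrow> s \<beta> < h i y" if "i \<in> J" for i
          using 1(5) that unfolding sel_def by (meson DiffI less_asym)
        moreover have "i \<in> A' \<longleftrightarrow> s \<beta> < h i y" if "i \<in> J" for i
          using 2(5) that unfolding sel_def \<beta> by (meson DiffI less_asym)
        ultimately have "A = A'" using 1(2) 2(2) by blast
        then show ?thesis using 1(3) 2(3) by simp
      qed
      have ex: "\<exists>c<m * n + 1. C j c" if "j \<in> {j \<in> J. y \<in> W j}" for j
        using that unfolding W_def C_def by blast
      then obtain c where c: "\<And>j. j \<in> {j \<in> J. y \<in> W j} \<Longrightarrow> c j < m * n + 1"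
        "\<And>j. j \<in> {j \<in> J. y \<in> W j} \<Longrightarrow> C j (c j)" by metis
      have "inj_on c {j \<in> J. y \<in> W j}"
      proof (rule inj_onI)
        fix j j' assume j: "j \<in> {j \<in> J. y \<in> W j}" and j': "j' \<in> {j \<in> J. y \<in> W j}" and eq: "c j = c j'"
        show "j = j'" using uniq[OF c(2)[OF j]] c(2)[OF j'] eq by simp
      qed
      then show ?thesis
        using card_inj_on_le[of c "{j \<in> J. y \<in> W j}" "{..<m * n + 1}"] c(1) by auto
    qed
    have cover: "\<exists>j\<in>J. y \<in> W j" if y: "y \<in> stratum E K r" and nv: "nonvanishing E K y G" for y G
    proof -
      obtain c \<beta> where c: "c < m * n + 1" "\<beta> \<in> cells c" "y \<in> Q \<beta>" using cell_exists[OF y nv] by blast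
      define A where "A = {j \<in> J. s \<beta> < h j y}"
      obtain j1 where "j1 \<in> J" "h j1 y = 1" using h(3)[OF str_Y[OF y]] by blast
      then have "A \<noteq> {}" using s(2)[OF c(2)] by (auto simp: A_def)
      moreover have "sel \<beta> A y"
        using s(3)[OF c(2,3) y] by (force simp: sel_def A_def)
      ultimately have "y \<in> W (p A)"
        using c str_Y[OF y] unfolding W_def A_def by blast
      moreover have "p A \<in> J" using p[OF \<open>A \<noteq> {}\<close>] by (simp add: A_def)
      ultimately show ?thesis by blast
    qed
    show "\<exists>W. (\<forall>j\<in>J. functionally_open Y (W j) \<and> W j \<subseteq> V j) \<and>
        (\<forall>y\<in>stratum E K r. card {j \<in> J. y \<in> W j} \<le> m * n + 1 \<and>
          ((\<exists>G. nonvanishing E K y G) \<longrightarrow> (\<exists>j\<in>J. y \<in> W j)))"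
      using foW WV order cover by (intro exI[of _ W]) blast
  qed
qed

text \<open>In the induction step, a cover that is good on the stratum for k - 1 is good even on a cozero
  neighbourhood of it. Outside this neighbourhood each point of the stratum for k has exactly k atoms,
  so the cells take over there.\<close>

lemma stratum_cover_shrinking:
  fixes J :: "'i set" and U :: "'i \<Rightarrow> 'b set"
  assumes J: "finite J" and "k \<le> m" and "0 \<le> r"
    and "\<And>j. j \<in> J \<Longrightarrow> functionally_open Y (U j)" "(\<Union>j\<in>J. U j) = topspace Y"
  shows "\<exists>E V. countable E \<and> E \<subseteq> DX \<and> (\<forall>j\<in>J. functionally_open Y (V j) \<and> V j \<subseteq> U j) \<and>
    (\<Union>j\<in>J. V j) = topspace Y \<and> (\<forall>y\<in>stratum E k r. card {j \<in> J. y \<in> V j} \<le> m * n + 1)"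
  using assms(2,4,5)
proof (induction k arbitrary: U)
  case 0
  \<comment> \<open>With \<open>T f = 1\<close> on Y, a point of the stratum for 0 would have no
    atoms and thus \<open>T f y = 0\<close>. So this stratum is empty and the cover needs no
    change.\<close>
  obtain f where f: "f \<in> DX" "\<And>y. y \<in> topspace Y \<Longrightarrow> T f y = 1"
    using onto[of "\<lambda>_. 1"] by auto
  have "stratum {f} 0 r = {}"
  proof (rule ccontr)
    assume "stratum {f} 0 r \<noteq> {}"
    then obtain y where y: "y \<in> stratum {f} 0 r" by blast
    then have yY: "y \<in> topspace Y" by (simp add: stratum_def)
    obtain S \<alpha> where rep: "represents {f} y S \<alpha>" using represents_exists[of "{f}" y] f(1) yY by auto
    then have "S = {}" using stratum_weights(1)[OF rep y] by (auto simp: represents_def)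
    then have "T f y = 0" using rep by (simp add: represents_def)
    then show False using f(2)[OF yY] by simp
  qed
  show ?case
  proof (intro exI[of _ "{f}"] exI[of _ U] conjI ballI)
    show "(\<Union>j\<in>J. U j) = topspace Y" by (rule 0)
  qed (use f(1) 0(2) \<open>stratum {f} 0 r = {}\<close> in simp_all)
next
  case (Suc k)
  have "\<exists>E V. countable E \<and> E \<subseteq> DX \<and> (\<forall>j\<in>J. functionally_open Y (V j) \<and> V j \<subseteq> U j) \<and>
      (\<Union>j\<in>J. V j) = topspace Y \<and> (\<forall>y\<in>stratum E k r. card {j \<in> J. y \<in> V j} \<le> m * n + 1)"
    by (rule Suc.IH[OF _ Suc.prems(2,3)]) (use Suc.prems(1) in simp_all)
  then obtain E0 V0 where E0: "countable E0" "E0 \<subseteq> DX"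
    and V0': "\<forall>j\<in>J. functionally_open Y (V0 j) \<and> V0 j \<subseteq> U j" and V0_cover: "(\<Union>j\<in>J. V0 j) = topspace Y"
    and V0_card: "\<forall>y\<in>stratum E0 k r. card {j \<in> J. y \<in> V0 j} \<le> m * n + 1"
    by (elim exE conjE)
  have V0: "functionally_open Y (V0 j)" "V0 j \<subseteq> U j" if "j \<in> J" for j
    using V0' that by blast+
  obtain g where g: "\<And>j. j \<in> J \<Longrightarrow> continuous_map Y euclideanreal (g j)"
    "\<And>j. j \<in> J \<Longrightarrow> V0 j = {y \<in> topspace Y. 0 < g j y}"
    "\<And>y. y \<in> topspace Y \<Longrightarrow> \<exists>j\<in>J. g j y = 1"
    "\<And>j y. j \<in> J \<Longrightarrow> y \<in> topspace Y \<Longrightarrow> 0 \<le> g j y \<and> g j y \<le> (1::real)"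
    by (rule functionally_open_cover_normalise[OF J V0(1) V0_cover]) blast+
  \<comment> \<open>The zero sets {1/2 \<le> g} lie between \<open>V1 j\<close> and
    \<open>V0 j\<close>. Counting them as \<open>ord\<close> bounds the order of \<open>V1\<close>,
    and smallness of \<open>ord\<close> is a cozero condition.\<close>
  define V1 where "V1 j = {y \<in> topspace Y. 1/2 < g j y}" for j
  have V1: "functionally_open Y (V1 j)" if "j \<in> J" for j
    unfolding V1_def by (intro functionally_open_less g that) auto
  have V1_cover: "(\<Union>j\<in>J. V1 j) = topspace Y"
  proof
    show "topspace Y \<subseteq> (\<Union>j\<in>J. V1 j)"
    proof
      fix y assume y: "y \<in> topspace Y"
      obtain j where "j \<in> J" "g j y = 1" using g(3)[OF y] by blast
      then show "y \<in> (\<Union>j\<in>J. V1 j)" using y by (intro UN_I[of j]) (auto simp: V1_def)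
    qed
  qed (auto simp: V1_def)
  have V1_V0: "V1 j \<subseteq> V0 j" if "j \<in> J" for j
    using g(2)[OF that] unfolding V1_def by force

  define ord where "ord y = card {j \<in> J. 1/2 \<le> g j y}" for y
  have ord_small: "ord y \<le> m * n + 1" if y: "y \<in> stratum E0 k r" for y
  proof -
    have yY: "y \<in> topspace Y" using y by (simp add: stratum_def)
    have "j \<in> {j \<in> J. y \<in> V0 j}" if "j \<in> {j \<in> J. 1/2 \<le> g j y}" for j
      using g(2)[of j] that yY by (force)
    then have "ord y \<le> card {j \<in> J. y \<in> V0 j}"
      unfolding ord_def using J by (intro card_mono) auto
    then show ?thesis using bspec[OF V0_card y] by simp
  qed
  have ord_open: "functionally_open Y {y \<in> topspace Y. ord y \<le> m * n + 1}"
  proof -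
    let ?\<A> = "{A. A \<subseteq> J \<and> card A = m * n + 2}"
    have eq: "ord y \<le> m * n + 1 \<longleftrightarrow> (\<forall>A\<in>?\<A>. \<exists>j\<in>A. g j y < 1/2)" for y
    proof
      assume o: "ord y \<le> m * n + 1"
      show "\<forall>A\<in>?\<A>. \<exists>j\<in>A. g j y < 1/2"
      proof (rule ballI, rule ccontr)
        fix A assume A: "A \<in> ?\<A>" and "\<not> (\<exists>j\<in>A. g j y < 1/2)"
        then have "A \<subseteq> {j \<in> J. 1/2 \<le> g j y}" by force
        then have "card A \<le> ord y" unfolding ord_def using J by (intro card_mono) auto
        then show False using A o by simp
      qed
    next
      assume *: "\<forall>A\<in>?\<A>. \<exists>j\<in>A. g j y < 1/2"
      show "ord y \<le> m * n + 1"
      proof (rule ccontr)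
        assume "\<not> ?thesis"
        then have "m * n + 2 \<le> card {j \<in> J. 1/2 \<le> g j y}" by (simp add: ord_def)
        then obtain A where A: "A \<subseteq> {j \<in> J. 1/2 \<le> g j y}" "card A = m * n + 2"
          using obtain_subset_with_card_n by metis
        then have "A \<in> ?\<A>" by auto
        then obtain j where "j \<in> A" "g j y < 1/2" using * by blast
        then show False using A(1) by force
      qed
    qed
    have "functionally_open Y {y \<in> topspace Y. \<forall>A\<in>?\<A>. \<exists>j\<in>A. g j y < 1/2}"
    proof (rule functionally_open_finite_All)
      show "functionally_open Y {y \<in> topspace Y. \<exists>j\<in>A. g j y < 1/2}" if "A \<in> ?\<A>" for A
        using that J
        by (intro functionally_open_countable_Ex functionally_open_less g)
           (auto intro: countable_finite finite_subset)
    qed (use J in simp)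
    then show ?thesis unfolding eq .
  qed

  obtain E1 where E1: "countable E1" "E1 \<subseteq> DX"
    "\<And>E'. countable E' \<Longrightarrow> E1 \<subseteq> E' \<Longrightarrow> E' \<subseteq> DX \<Longrightarrow>
      \<exists>W. (\<forall>j\<in>J. functionally_open Y (W j) \<and> W j \<subseteq> V1 j) \<and>
        (\<forall>y\<in>stratum E' (Suc k) r. card {j \<in> J. y \<in> W j} \<le> m * n + 1 \<and>
          ((\<exists>G. nonvanishing E' (Suc k) y G) \<longrightarrow> (\<exists>j\<in>J. y \<in> W j)))"
    by (rule stratum_cells[OF J V1 V1_cover Suc.prems(1) \<open>0 \<le> r\<close>]) blast+
  \<comment> \<open>The cells work for every countable extension of \<open>E1\<close> within DX, so
    \<open>E0\<close> can be added; the larger set only shrinks the stratum on which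
    \<open>V0\<close> is controlled.\<close>
  define E where "E = E0 \<union> E1"
  have E: "countable E" "E \<subseteq> DX" "E1 \<subseteq> E" "E0 \<subseteq> E"
    using E0 E1 by (auto simp: E_def)
  obtain W where W': "\<forall>j\<in>J. functionally_open Y (W j) \<and> W j \<subseteq> V1 j"
    "\<forall>y\<in>stratum E (Suc k) r. card {j \<in> J. y \<in> W j} \<le> m * n + 1 \<and>
      ((\<exists>G. nonvanishing E (Suc k) y G) \<longrightarrow> (\<exists>j\<in>J. y \<in> W j))"
    using E1(3)[OF E(1,3,2)] by (elim exE conjE)
  then have W: "\<And>j. j \<in> J \<Longrightarrow> functionally_open Y (W j)" "\<And>j. j \<in> J \<Longrightarrow> W j \<subseteq> V1 j"
    "\<And>y. y \<in> stratum E (Suc k) r \<Longrightarrow> card {j \<in> J. y \<in> W j} \<le> m * n + 1"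
    "\<And>y G. y \<in> stratum E (Suc k) r \<Longrightarrow> nonvanishing E (Suc k) y G \<Longrightarrow> \<exists>j\<in>J. y \<in> W j"
    by blast+
  \<comment> \<open>The set where \<open>V1\<close> may be kept: off the stratum for
    \<open>Suc k\<close> no order is claimed, and elsewhere \<open>ord\<close> already bounds
    it.\<close>
  define outside where "outside y \<longleftrightarrow> y \<notin> stratum E (Suc k) r \<or> ord y \<le> m * n + 1" for y
  have outside_open: "functionally_open Y {y \<in> topspace Y. outside y}"
    unfolding outside_def
    by (intro functionally_open_disj functionally_open_complement_stratum E ord_open)
  define V where "V j = W j \<union> (V1 j \<inter> {y \<in> topspace Y. outside y})" for j
  have covered: "\<exists>j\<in>J. y \<in> V j" if y: "y \<in> topspace Y" for y
  proof (cases "outside y")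
    case True
    then show ?thesis using y V1_cover by (auto simp: V_def)
  next
    case False
    then have yE: "y \<in> stratum E (Suc k) r" and "\<not> ord y \<le> m * n + 1" by (auto simp: outside_def)
    then have "y \<notin> stratum E k r" using ord_small stratum_mono[OF E(4)] by blast
    then obtain G where "nonvanishing E (Suc k) y G" using yE by (auto simp: stratum_def)
    then show ?thesis using W(4)[OF yE] by (auto simp: V_def)
  qed
  show ?case
  proof (intro exI[of _ E] exI[of _ V] conjI ballI E)
    show "functionally_open Y (V j)" if "j \<in> J" for j
    proof -
      have "functionally_open Y (\<Union>A\<in>{W j, V1 j \<inter> {y \<in> topspace Y. outside y}}. A)"
        by (rule functionally_open_countable_Union)
           (use W(1) V1 outside_open that in \<open>auto intro: functionally_open_Int\<close>)
      then show ?thesis by (simp add: V_def)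
    qed
    show VU: "V j \<subseteq> U j" if "j \<in> J" for j
      using W(2) V1_V0 V0(2) that unfolding V_def by blast
    show "(\<Union>j\<in>J. V j) = topspace Y"
      using covered VU Suc.prems(3) by blast
    show "card {j \<in> J. y \<in> V j} \<le> m * n + 1" if y: "y \<in> stratum E (Suc k) r" for y
    proof (cases "outside y")
      case True
      then have "ord y \<le> m * n + 1" using y by (simp add: outside_def)
      moreover have "{j \<in> J. y \<in> V j} \<subseteq> {j \<in> J. 1/2 \<le> g j y}"
        using W(2) by (force simp: V_def V1_def)
      then have "card {j \<in> J. y \<in> V j} \<le> ord y"
        unfolding ord_def using J by (intro card_mono) auto
      ultimately show ?thesis by simp
    next
      case False
      then have "{j \<in> J. y \<in> V j} = {j \<in> J. y \<in> W j}" by (auto simp: V_def)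
      then show ?thesis using W(3)[OF y] by simp
    qed
  qed
qed

section \<open>Exhaustion of Y by bounded parts and the countable sum argument\<close>

text \<open>Uses an exact representation of the functional, independent of any E, so these sets stay
  fixed while the cover and E change. They need not be zero sets; the strata that contain them
  are.\<close>

definition bounded_part :: "nat \<Rightarrow> 'b set" where
  "bounded_part r = {y \<in> topspace Y. \<exists>S \<alpha>. finite S \<and> S \<subseteq> topspace X \<and> card S \<le> m \<and>
     (\<forall>f\<in>DX. T f y = (\<Sum>x\<in>S. \<alpha> x * f x)) \<and> (\<Sum>x\<in>S. \<bar>\<alpha> x\<bar>) \<le> real r}"

lemma bounded_part_covers:
  assumes "y \<in> topspace Y"
  shows "\<exists>r. y \<in> bounded_part r"
proof -
  obtain S \<alpha> where "finite S" "S \<subseteq> topspace X" "card S \<le> m" "\<forall>f\<in>DX. T f y = (\<Sum>x\<in>S. \<alpha> x * f x)"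
    using finite_support[OF assms] by blast
  moreover obtain r where "(\<Sum>x\<in>S. \<bar>\<alpha> x\<bar>) \<le> real r" using real_arch_simple by blast
  ultimately show ?thesis using assms unfolding bounded_part_def by blast
qed

lemma bounded_part_subset_stratum:
  assumes "E \<subseteq> DX"
  shows "bounded_part r \<subseteq> stratum E m (real r)"
proof
  fix y assume "y \<in> bounded_part r"
  then obtain S \<alpha> where y: "y \<in> topspace Y" and S: "finite S" "S \<subseteq> topspace X" "card S \<le> m"
    "\<And>f. f \<in> DX \<Longrightarrow> T f y = (\<Sum>x\<in>S. \<alpha> x * f x)" "(\<Sum>x\<in>S. \<bar>\<alpha> x\<bar>) \<le> real r"
    unfolding bounded_part_def by blast
  have T: "T e y = (\<Sum>x\<in>S. \<alpha> x * e x)" if "e \<in> test_functions X E" for e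
    using S(4) test_functions_DX[OF assms] that by blast
  have "\<bar>T e y\<bar> \<le> real r" if e: "e \<in> test_functions X E" for e
  proof -
    have "\<bar>T e y\<bar> \<le> (\<Sum>x\<in>S. \<bar>\<alpha> x * e x\<bar>)" unfolding T[OF e] by (rule sum_abs)
    also have "\<dots> \<le> (\<Sum>x\<in>S. \<bar>\<alpha> x\<bar>)"
    proof (rule sum_mono)
      fix x assume "x \<in> S"
      then have "\<bar>e x\<bar> \<le> 1" using test_function_bounds[OF e, of x] S(2) by auto
      then show "\<bar>\<alpha> x * e x\<bar> \<le> \<bar>\<alpha> x\<bar>" by (simp add: abs_mult mult_left_le)
    qed
    finally show ?thesis using S(5) by simp
  qed
  moreover have False if G: "nonvanishing E (Suc m) y G" for G
  proof -
    have "\<forall>e\<in>G. \<exists>x. x \<in> S \<and> e x \<noteq> 0"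
    proof (rule ballI, rule ccontr)
      fix e assume e: "e \<in> G" and "\<not> (\<exists>x. x \<in> S \<and> e x \<noteq> 0)"
      then have "(\<Sum>x\<in>S. \<alpha> x * e x) = 0" by simp
      then show False using T[of e] G e by (auto simp: nonvanishing_def)
    qed
    then obtain p where p: "\<And>e. e \<in> G \<Longrightarrow> p e \<in> S" "\<And>e. e \<in> G \<Longrightarrow> e (p e) \<noteq> 0" by metis
    have "inj_on p G"
    proof (rule inj_onI, rule ccontr)
      fix e e' assume "e \<in> G" "e' \<in> G" "p e = p e'" "e \<noteq> e'"
      then show False using G p S(2) unfolding nonvanishing_def disjoint_functions_def by (metis subsetD)
    qed
    then have "card G \<le> card S" using p S(1) by (intro card_inj_on_le[of p]) auto
    then show False using G S(3) by (simp add: nonvanishing_def)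
  qed
  ultimately show "y \<in> stratum E m (real r)" using y unfolding stratum_def by blast
qed

text \<open>The order is bounded for the zero sets F and not merely for V, because zero sets survive
  the countable intersection to come.\<close>

lemma bounded_part_cover_shrinking:
  fixes J :: "'i set" and U :: "'i \<Rightarrow> 'b set"
  assumes J: "finite J" and U: "\<And>j. j \<in> J \<Longrightarrow> functionally_open Y (U j)" "(\<Union>j\<in>J. U j) = topspace Y"
  shows "\<exists>V F. (\<forall>j\<in>J. functionally_open Y (V j) \<and> functionally_open Y (topspace Y - F j) \<and> V j \<subseteq> F j \<and> F j \<subseteq> U j) \<and>
    (\<Union>j\<in>J. V j) = topspace Y \<and> (\<forall>y\<in>bounded_part r. card {j \<in> J. y \<in> F j} \<le> m * n + 1)"
proof -
  have "\<exists>E V. countable E \<and> E \<subseteq> DX \<and> (\<forall>j\<in>J. functionally_open Y (V j) \<and> V j \<subseteq> U j) \<and>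
      (\<Union>j\<in>J. V j) = topspace Y \<and> (\<forall>y\<in>stratum E m (real r). card {j \<in> J. y \<in> V j} \<le> m * n + 1)"
    by (rule stratum_cover_shrinking[OF J order_refl of_nat_0_le_iff U])
  then obtain E V where E: "E \<subseteq> DX"
    and V': "\<forall>j\<in>J. functionally_open Y (V j) \<and> V j \<subseteq> U j" and V_cover: "(\<Union>j\<in>J. V j) = topspace Y"
    and V_card: "\<forall>y\<in>stratum E m (real r). card {j \<in> J. y \<in> V j} \<le> m * n + 1"
    by (elim exE conjE)
  have V: "functionally_open Y (V j)" "V j \<subseteq> U j" if "j \<in> J" for j
    using V' that by blast+
  obtain g where g: "\<And>j. j \<in> J \<Longrightarrow> continuous_map Y euclideanreal (g j)"
    "\<And>j. j \<in> J \<Longrightarrow> V j = {y \<in> topspace Y. 0 < g j y}"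
    "\<And>y. y \<in> topspace Y \<Longrightarrow> \<exists>j\<in>J. g j y = 1"
    "\<And>j y. j \<in> J \<Longrightarrow> y \<in> topspace Y \<Longrightarrow> 0 \<le> g j y \<and> g j y \<le> (1::real)"
    by (rule functionally_open_cover_normalise[OF J V(1) V_cover]) blast+
  define V' where "V' j = {y \<in> topspace Y. 1/2 < g j y}" for j
  define F where "F j = {y \<in> topspace Y. 1/2 \<le> g j y}" for j
  have FV: "F j \<subseteq> V j" if "j \<in> J" for j
    using g(2)[OF that] unfolding F_def by force
  show ?thesis
  proof (rule exI[of _ V'], rule exI[of _ F], intro conjI ballI)
    show "functionally_open Y (V' j)" if "j \<in> J" for j
      unfolding V'_def by (intro functionally_open_less g that) auto
    show "functionally_open Y (topspace Y - F j)" if "j \<in> J" for j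
    proof -
      have "topspace Y - F j = {y \<in> topspace Y. g j y < 1/2}" by (auto simp: F_def)
      also have "functionally_open Y \<dots>" by (intro functionally_open_less g that) auto
      finally show ?thesis .
    qed
    show "V' j \<subseteq> F j" for j by (auto simp: V'_def F_def)
    show "F j \<subseteq> U j" if "j \<in> J" for j using FV V(2) that by blast
    show "(\<Union>j\<in>J. V' j) = topspace Y"
    proof
      show "topspace Y \<subseteq> (\<Union>j\<in>J. V' j)"
      proof
        fix y assume y: "y \<in> topspace Y"
        obtain j where "j \<in> J" "g j y = 1" using g(3)[OF y] by blast
        then show "y \<in> (\<Union>j\<in>J. V' j)" using y by (intro UN_I[of j]) (auto simp: V'_def)
      qed
    qed (auto simp: V'_def)
    show "card {j \<in> J. y \<in> F j} \<le> m * n + 1" if "y \<in> bounded_part r" for y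
    proof -
      have "y \<in> stratum E m (real r)" using bounded_part_subset_stratum[OF E] that by blast
      moreover have "card {j \<in> J. y \<in> F j} \<le> card {j \<in> J. y \<in> V j}"
        using FV J by (intro card_mono) auto
      ultimately show ?thesis using V_card by fastforce
    qed
  qed
qed

text \<open>Shrinking successively for r = 0, 1, ... gives decreasing zero sets
  \<open>F r j\<close>. Their intersections have small order at every point, since each point lies
  in some bounded part, and they still cover because J is finite. Being zero sets, they are finally
  swelled to cozero sets.\<close>

lemma cover_shrinking:
  fixes J :: "'i set" and U :: "'i \<Rightarrow> 'b set"
  assumes J: "finite J" and U: "\<And>j. j \<in> J \<Longrightarrow> functionally_open Y (U j)" "(\<Union>j\<in>J. U j) = topspace Y"
  obtains V where "\<And>j. j \<in> J \<Longrightarrow> functionally_open Y (V j)" "\<And>j. j \<in> J \<Longrightarrow> V j \<subseteq> U j"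
    "(\<Union>j\<in>J. V j) = topspace Y" "\<And>y. y \<in> topspace Y \<Longrightarrow> card {j \<in> J. y \<in> V j} \<le> m * n + 1"
proof -
  define cover where "cover A \<longleftrightarrow> (\<forall>j\<in>J. functionally_open Y (A j)) \<and> (\<Union>j\<in>J. A j) = topspace Y" for A
  define step where "step r A B F \<longleftrightarrow> (\<forall>j\<in>J. functionally_open Y (topspace Y - F j) \<and> B j \<subseteq> F j \<and> F j \<subseteq> A j) \<and>
      (\<forall>y\<in>bounded_part r. card {j \<in> J. y \<in> F j} \<le> m * n + 1)" for r A B F
  have ex: "\<exists>B. cover B \<and> (\<exists>F. step r A B F)" if "cover A" for r A
  proof -
    have A: "\<And>j. j \<in> J \<Longrightarrow> functionally_open Y (A j)" "(\<Union>j\<in>J. A j) = topspace Y"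
      using \<open>cover A\<close> by (simp_all add: cover_def)
    obtain B F where
      "\<forall>j\<in>J. functionally_open Y (B j) \<and> functionally_open Y (topspace Y - F j) \<and> B j \<subseteq> F j \<and> F j \<subseteq> A j"
      "(\<Union>j\<in>J. B j) = topspace Y" "\<forall>y\<in>bounded_part r. card {j \<in> J. y \<in> F j} \<le> m * n + 1"
    proof -
      have "\<exists>B F. (\<forall>j\<in>J. functionally_open Y (B j) \<and> functionally_open Y (topspace Y - F j) \<and> B j \<subseteq> F j \<and> F j \<subseteq> A j) \<and>
          (\<Union>j\<in>J. B j) = topspace Y \<and> (\<forall>y\<in>bounded_part r. card {j \<in> J. y \<in> F j} \<le> m * n + 1)"
        by (rule bounded_part_cover_shrinking[OF J A])
      then show ?thesis using that by (elim exE conjE)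
    qed
    then have "cover B" "step r A B F" by (simp_all add: cover_def step_def)
    then show ?thesis by blast
  qed
  have "cover U" using U by (simp add: cover_def)
  \<comment> \<open>The clause for stage 0 is part of the invariant so that the chain given by
    dependent choice starts at U.\<close>
  have start: "\<exists>A. cover A \<and> ((0::nat) = 0 \<longrightarrow> A = U)" using \<open>cover U\<close> by blast
  have next_cover: "\<exists>B. (cover B \<and> (Suc r = 0 \<longrightarrow> B = U)) \<and> (\<exists>F. step r A B F)"
    if "cover A \<and> (r = 0 \<longrightarrow> A = U)" for A r
    using ex[of A r] that by simp
  obtain A where A': "\<And>r. cover (A r) \<and> (r = 0 \<longrightarrow> A r = U)" "\<And>r. \<exists>F. step r (A r) (A (Suc r)) F"
    using dependent_nat_choice[of "\<lambda>r A. cover A \<and> (r = 0 \<longrightarrow> A = U)" "\<lambda>r A B. \<exists>F. step r A B F",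
        OF start next_cover] by blast
  then obtain F where "\<And>r. step r (A r) (A (Suc r)) (F r)"
    by metis
  then have A: "\<And>r. cover (A r)" "\<And>r. step r (A r) (A (Suc r)) (F r)" "A 0 = U"
    using A'(1) by blast+
  have dec: "F (Suc r) j \<subseteq> F r j" if "j \<in> J" for r j
    using A(2)[of r] A(2)[of "Suc r"] that unfolding step_def by blast
  have mono: "F s j \<subseteq> F r j" if "j \<in> J" "r \<le> s" for r s j
    using that(2) by (induction rule: dec_induct) (use dec[OF that(1)] in blast)+
  define H where "H j = (\<Inter>r. F r j)" for j
  have foH: "functionally_open Y (topspace Y - H j)" if "j \<in> J" for j
  proof -
    have "topspace Y - H j = (\<Union>r. topspace Y - F r j)" by (auto simp: H_def)
    then show ?thesis
      using A(2) that functionally_open_UN_nat[of Y "\<lambda>r. topspace Y - F r j"] unfolding step_def by simp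
  qed
  have HU: "H j \<subseteq> U j" if "j \<in> J" for j
    using A(2)[of 0] that unfolding step_def A(3) H_def by blast
  have ordH: "card {j \<in> J. y \<in> H j} \<le> m * n + 1" if y: "y \<in> topspace Y" for y
  proof -
    obtain r where "y \<in> bounded_part r" using bounded_part_covers[OF y] by blast
    then have "card {j \<in> J. y \<in> F r j} \<le> m * n + 1" using A(2)[of r] unfolding step_def by blast
    moreover have "card {j \<in> J. y \<in> H j} \<le> card {j \<in> J. y \<in> F r j}"
      using J by (intro card_mono) (auto simp: H_def)
    ultimately show ?thesis by simp
  qed
  have coverH: "\<exists>j\<in>J. y \<in> H j" if y: "y \<in> topspace Y" for y
  proof (rule ccontr)
    assume "\<not> ?thesis"
    then have "\<forall>j\<in>J. \<exists>r. y \<notin> F r j" by (auto simp: H_def)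
    then obtain \<rho> where \<rho>: "\<And>j. j \<in> J \<Longrightarrow> y \<notin> F (\<rho> j) j" by metis
    \<comment> \<open>As the chains decrease, y has left all of them by stage s, yet the cover
      \<open>A (Suc s)\<close> lies inside the sets \<open>F s\<close>.\<close>
    define s where "s = Max (insert 0 (\<rho> ` J))"
    have "\<rho> j \<le> s" if "j \<in> J" for j using J that by (simp add: s_def)
    then have no: "y \<notin> F s j" if "j \<in> J" for j using mono \<rho> that by blast
    have "y \<in> (\<Union>j\<in>J. A (Suc s) j)" using A(1)[of "Suc s"] y by (simp add: cover_def)
    then show False using no A(2)[of s] unfolding step_def by blast
  qed
  obtain V where V: "\<And>j. j \<in> J \<Longrightarrow> functionally_open Y (V j)" "\<And>j. j \<in> J \<Longrightarrow> H j \<inter> topspace Y \<subseteq> V j"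
    "\<And>j. j \<in> J \<Longrightarrow> V j \<subseteq> U j" "\<And>y. y \<in> topspace Y \<Longrightarrow> card {j \<in> J. y \<in> V j} \<le> m * n + 1"
    using closed_cover_swelling[OF J U(1) foH HU ordH] by blast
  have V_cover: "(\<Union>j\<in>J. V j) = topspace Y"
  proof
    show "topspace Y \<subseteq> (\<Union>j\<in>J. V j)"
    proof
      fix y assume y: "y \<in> topspace Y"
      then obtain j where "j \<in> J" "y \<in> H j" using coverH by blast
      then show "y \<in> (\<Union>j\<in>J. V j)" using V(2)[of j] y by blast
    qed
    show "(\<Union>j\<in>J. V j) \<subseteq> topspace Y" using V(1) functionally_open_subset by blast
  qed
  show ?thesis by (rule that[of V]) (fact V V_cover)+
qed

lemma covering_dim_le_codomain: "covering_dim_le Y (m * n)"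
  unfolding covering_dim_le_def
proof (intro allI impI)
  fix \<U> assume "finite_functionally_open_cover Y \<U>"
  then have \<U>: "finite \<U>" "\<And>U. U \<in> \<U> \<Longrightarrow> functionally_open Y U" "(\<Union>U\<in>\<U>. U) = topspace Y"
    by (auto simp: finite_functionally_open_cover_def)
  obtain V where V: "\<And>U. U \<in> \<U> \<Longrightarrow> functionally_open Y (V U)" "\<And>U. U \<in> \<U> \<Longrightarrow> V U \<subseteq> U"
    "(\<Union>U\<in>\<U>. V U) = topspace Y" "\<And>y. y \<in> topspace Y \<Longrightarrow> card {U \<in> \<U>. y \<in> V U} \<le> m * n + 1"
    by (rule cover_shrinking[OF \<U>]) auto
  show "\<exists>\<V>. finite_functionally_open_cover Y \<V> \<and> (\<forall>V\<in>\<V>. \<exists>U\<in>\<U>. V \<subseteq> U) \<and>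
      (\<forall>y\<in>topspace Y. card {V \<in> \<V>. y \<in> V} \<le> m * n + 1)"
  proof (intro exI[of _ "V ` \<U>"] conjI ballI)
    show "finite_functionally_open_cover Y (V ` \<U>)"
      using \<U>(1) V(1,3) by (auto simp: finite_functionally_open_cover_def)
    show "\<exists>U\<in>\<U>. W \<subseteq> U" if "W \<in> V ` \<U>" for W using V(2) that by blast
    show "card {W \<in> V ` \<U>. y \<in> W} \<le> m * n + 1" if "y \<in> topspace Y" for y
    proof -
      have "{W \<in> V ` \<U>. y \<in> W} = V ` {U \<in> \<U>. y \<in> V U}" by auto
      then have "card {W \<in> V ` \<U>. y \<in> W} \<le> card {U \<in> \<U>. y \<in> V U}"
        using \<U>(1) by (simp add: card_image_le)
      then show ?thesis using V(4)[OF that] by simp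
    qed
  qed
qed

end

section \<open>Continuous functionals for pointwise convergence and their supports\<close>

text \<open>A basic neighbourhood of 0 on which |\<phi>| < 1 restricts only finitely many
  coordinates. A function vanishing at these has all its multiples in the neighbourhood, so |c *
  \<phi> f| < 1 for every c.\<close>

lemma continuous_functional_finitely_determined:
  assumes D: "D = C_space X \<or> D = Cb_space X"
    and cont: "continuous_map (pointwise_topology X D) euclideanreal \<phi>"
    and scale: "\<And>c f. f \<in> D \<Longrightarrow> \<phi> (\<lambda>x\<in>topspace X. c * f x) = c * \<phi> f"
  obtains S where "finite S" "S \<subseteq> topspace X" "\<And>f. f \<in> D \<Longrightarrow> (\<And>x. x \<in> S \<Longrightarrow> f x = 0) \<Longrightarrow> \<phi> f = 0"
proof -
  define o' where "o' = (\<lambda>x\<in>topspace X. 0::real)"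
  have top: "topspace (pointwise_topology X D) = D"
    using D by (auto simp: pointwise_topology_def C_space_def Cb_space_def PiE_def)
  have oD: "o' \<in> D"
    using restrict_in_Cb_space[of X "\<lambda>_. 0" 0] D by (auto simp: o'_def Cb_space_def)
  have "\<phi> o' = 0"
  proof -
    have "(\<lambda>x\<in>topspace X. 0 * o' x) = o'" by (auto simp: o'_def)
    then show ?thesis using scale[OF oD, of 0] by simp
  qed
  have "openin (pointwise_topology X D) {f \<in> topspace (pointwise_topology X D). \<phi> f \<in> {-1<..<1}}"
    by (rule openin_continuous_map_preimage[OF cont]) auto
  then obtain W where W: "openin (powertop_real (topspace X)) W" "{f \<in> D. \<phi> f \<in> {-1<..<1}} = W \<inter> D"
    unfolding top unfolding pointwise_topology_def openin_subtopology by (elim exE conjE)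
  have "o' \<in> {f \<in> D. \<phi> f \<in> {-1<..<1}}" using oD \<open>\<phi> o' = 0\<close> by simp
  then have "o' \<in> W" unfolding W(2) by (rule IntD1)
  then obtain B where B: "finite {i \<in> topspace X. B i \<noteq> UNIV}" "o' \<in> Pi\<^sub>E (topspace X) B" "Pi\<^sub>E (topspace X) B \<subseteq> W"
  proof -
    have "\<exists>B. finite {i \<in> topspace X. B i \<noteq> topspace euclideanreal} \<and>
        (\<forall>i\<in>topspace X. openin euclideanreal (B i)) \<and> o' \<in> Pi\<^sub>E (topspace X) B \<and> Pi\<^sub>E (topspace X) B \<subseteq> W"
      using W(1) \<open>o' \<in> W\<close> unfolding openin_product_topology_alt by (rule bspec)
    then obtain B where "finite {i \<in> topspace X. B i \<noteq> topspace euclideanreal}"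
      "o' \<in> Pi\<^sub>E (topspace X) B" "Pi\<^sub>E (topspace X) B \<subseteq> W" by (elim exE conjE)
    then show ?thesis by (intro that[of B]) simp_all
  qed
  show ?thesis
  proof (rule that[OF B(1)])
    fix f assume f: "f \<in> D" and zero: "\<And>x. x \<in> {i \<in> topspace X. B i \<noteq> UNIV} \<Longrightarrow> f x = 0"
    have small: "\<bar>c * \<phi> f\<bar> < 1" for c
    proof -
      have cf: "(\<lambda>x\<in>topspace X. c * f x) \<in> D" by (rule function_space_scale[OF D f])
      have "(\<lambda>x\<in>topspace X. c * f x) \<in> Pi\<^sub>E (topspace X) B"
      proof (rule PiE_I)
        fix x assume x: "x \<in> topspace X"
        show "(\<lambda>x\<in>topspace X. c * f x) x \<in> B x"
        proof (cases "B x = UNIV")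
          case False
          have "o' x \<in> B x" using B(2) x by blast
          then show ?thesis using zero[of x] False x by (simp add: o'_def)
        qed simp
      qed simp
      then have "(\<lambda>x\<in>topspace X. c * f x) \<in> {f \<in> D. \<phi> f \<in> {-1<..<1}}"
        unfolding W(2) using B(3) cf by blast
      then show ?thesis using scale[OF f, of c] by auto
    qed
    show "\<phi> f = 0"
    proof (rule ccontr)
      assume "\<phi> f \<noteq> 0"
      then show False using small[of "1 / \<phi> f"] by simp
    qed
  qed auto
qed

text \<open>For bumps \<open>h x\<close> dual to the points of S, the difference of f and the sum of
  all \<open>f x * h x\<close> vanishes on S and is annihilated, so the weights are
  \<open>\<phi> (h x)\<close>. Zero weights are dropped so that every remaining atom lies in the
  support.\<close>

lemma continuous_functional_finite_sum:
  assumes X: "tychonoff_space X" and D: "D = C_space X \<or> D = Cb_space X"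
    and cont: "continuous_map (pointwise_topology X D) euclideanreal \<phi>"
    and add: "\<And>f g. f \<in> D \<Longrightarrow> g \<in> D \<Longrightarrow> \<phi> (\<lambda>x\<in>topspace X. f x + g x) = \<phi> f + \<phi> g"
    and scale: "\<And>c f. f \<in> D \<Longrightarrow> \<phi> (\<lambda>x\<in>topspace X. c * f x) = c * \<phi> f"
  obtains S \<alpha> where "finite S" "S \<subseteq> topspace X" "\<And>x. x \<in> S \<Longrightarrow> \<alpha> x \<noteq> 0"
    "\<And>f. f \<in> D \<Longrightarrow> \<phi> f = (\<Sum>x\<in>S. \<alpha> x * f x)"
proof -
  obtain S where S: "finite S" "S \<subseteq> topspace X" "\<And>f. f \<in> D \<Longrightarrow> (\<And>x. x \<in> S \<Longrightarrow> f x = 0) \<Longrightarrow> \<phi> f = 0"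
    by (rule continuous_functional_finitely_determined[OF D cont scale]) auto
  have CbD: "Cb_space X \<subseteq> D" using D by (auto simp: Cb_space_def)
  have "\<forall>x\<in>S. \<exists>h. h \<in> D \<and> h x = 1 \<and> (\<forall>z\<in>S. z \<noteq> x \<longrightarrow> h z = 0)"
  proof
    fix x assume "x \<in> S"
    then show "\<exists>h. h \<in> D \<and> h x = 1 \<and> (\<forall>z\<in>S. z \<noteq> x \<longrightarrow> h z = 0)"
      using tychonoff_bump[OF X openin_topspace _ S(1), of x] S(2) CbD by (metis subsetD)
  qed
  then obtain h where h: "\<And>x. x \<in> S \<Longrightarrow> h x \<in> D" "\<And>x. x \<in> S \<Longrightarrow> h x x = (1::real)"
    "\<And>x z. x \<in> S \<Longrightarrow> z \<in> S \<Longrightarrow> z \<noteq> x \<Longrightarrow> h x z = 0"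
    by metis
  have comb: "(\<lambda>z\<in>topspace X. \<Sum>x\<in>A. c x * h x z) \<in> D \<and>
      \<phi> (\<lambda>z\<in>topspace X. \<Sum>x\<in>A. c x * h x z) = (\<Sum>x\<in>A. c x * \<phi> (h x))" if "A \<subseteq> S" for A c
    using finite_subset[OF that S(1)] that
  proof (induction A rule: finite_induct)
    case empty
    have 0: "(\<lambda>z\<in>topspace X. 0) \<in> D" using restrict_in_Cb_space[of X "\<lambda>_. 0" 0] CbD by auto
    moreover have "\<phi> (\<lambda>z\<in>topspace X. 0) = 0" by (rule S(3)[OF 0]) (use S(2) in auto)
    ultimately show ?case by (simp add: restrict_def)
  next
    case (insert x A)
    define u where "u = (\<lambda>z\<in>topspace X. c x * h x z)"
    define v where "v = (\<lambda>z\<in>topspace X. \<Sum>x\<in>A. c x * h x z)"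
    have u: "u \<in> D" "\<phi> u = c x * \<phi> (h x)"
      using insert.prems h(1) function_space_scale[OF D] scale by (auto simp: u_def)
    have v: "v \<in> D" "\<phi> v = (\<Sum>x\<in>A. c x * \<phi> (h x))" 
      using insert.IH insert.prems unfolding v_def by blast+
    have eq: "(\<lambda>z\<in>topspace X. \<Sum>x\<in>insert x A. c x * h x z) = (\<lambda>z\<in>topspace X. u z + v z)"
      by (rule restrict_ext) (use insert.hyps in \<open>simp add: u_def v_def\<close>)
    show ?case
      unfolding eq
    proof
      show "(\<lambda>z\<in>topspace X. u z + v z) \<in> D" by (rule function_space_add[OF D u(1) v(1)])
      show "\<phi> (\<lambda>z\<in>topspace X. u z + v z) = (\<Sum>x\<in>insert x A. c x * \<phi> (h x))"
        unfolding add[OF u(1) v(1)] using insert.hyps by (simp add: u(2) v(2))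
    qed
  qed
  have repr: "\<phi> f = (\<Sum>x\<in>S. \<phi> (h x) * f x)" if f: "f \<in> D" for f
  proof -
    define v where "v = (\<lambda>z\<in>topspace X. \<Sum>x\<in>S. - f x * h x z)"
    have v: "v \<in> D" "\<phi> v = (\<Sum>x\<in>S. - f x * \<phi> (h x))"
      using comb[OF subset_refl, of "\<lambda>x. - f x"] by (auto simp: v_def)
    have "f z + v z = 0" if z: "z \<in> S" for z
    proof -
      have "(\<Sum>x\<in>S. - f x * h x z) = (\<Sum>x\<in>S. if x = z then - f z else 0)"
        using h z by (intro sum.cong) auto
      then show ?thesis using z S(1,2) by (auto simp: v_def)
    qed
    then have "\<phi> (\<lambda>z\<in>topspace X. f z + v z) = 0"
      using S(2) by (intro S(3) function_space_add[OF D f v(1)]) auto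
    then show ?thesis
      using add[OF f v(1)] v(2) by (simp add: sum_negf mult.commute)
  qed
  show ?thesis
  proof (rule that[of "{x \<in> S. \<phi> (h x) \<noteq> 0}" "\<lambda>x. \<phi> (h x)"])
    show "\<phi> f = (\<Sum>x\<in>{x \<in> S. \<phi> (h x) \<noteq> 0}. \<phi> (h x) * f x)" if "f \<in> D" for f
      unfolding repr[OF that] using S(1) by (intro sum.mono_neutral_right) auto
  qed (use S in auto)
qed

text \<open>A bump that is 1 at an atom x, 0 at the other atoms and 0 off a given neighbourhood has
  image \<open>\<alpha> x \<noteq> 0\<close> at y, so x belongs to the support; distinct points of X
  stay distinct in \<beta>X.\<close>

lemma finite_sum_support_card_le:
  assumes X: "tychonoff_space X" and D: "D = C_space X \<or> D = Cb_space X"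
    and S: "finite S" "S \<subseteq> topspace X" "\<And>x. x \<in> S \<Longrightarrow> \<alpha> x \<noteq> 0"
    and T: "\<And>f. f \<in> D \<Longrightarrow> T f y = (\<Sum>x\<in>S. \<alpha> x * f x)"
    and fin: "finite (supp X D T y)"
  shows "card S \<le> card (supp X D T y)"
proof -
  note emb = beta_embed_embedding[OF X]
  have inj: "inj_on (beta_embed X) (topspace X)"
    using emb by (metis embedding_map_def homeomorphic_imp_injective_map)
  have cont: "continuous_map X (beta_space X) (beta_embed X)"
    using emb unfolding embedding_map_def
    by (meson continuous_map_in_subtopology homeomorphic_imp_continuous_map)
  have "beta_embed X x \<in> supp X D T y" if x: "x \<in> S" for x
    unfolding supp_def
  proof (intro CollectI conjI allI impI)
    show "beta_embed X x \<in> topspace (beta_space X)"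
      using continuous_map_image_subset_topspace[OF cont] x S(2) by blast
    fix U assume U: "openin (beta_space X) U \<and> beta_embed X x \<in> U"
    define U' where "U' = {z \<in> topspace X. beta_embed X z \<in> U}"
    have U': "openin X U'" unfolding U'_def using U by (intro openin_continuous_map_preimage[OF cont]) auto
    have xU': "x \<in> U'" using U x S(2) by (auto simp: U'_def)
    obtain f where f: "f \<in> Cb_space X" "f x = 1" "\<And>z. z \<in> topspace X \<Longrightarrow> z \<notin> U' \<Longrightarrow> f z = 0"
      "\<And>z. z \<in> S \<Longrightarrow> z \<in> topspace X \<Longrightarrow> z \<noteq> x \<Longrightarrow> f z = 0"
      by (rule tychonoff_bump[OF X U' xU' S(1)]) blast
    have fD: "f \<in> D" using f(1) D by (auto simp: Cb_space_def)
    have "(\<Sum>z\<in>S. \<alpha> z * f z) = (\<Sum>z\<in>S. if z = x then \<alpha> x else 0)"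
      using f(2,4) S(2) by (intro sum.cong) auto
    then have "T f y \<noteq> 0" using T[OF fD] S(1,3) x by simp
    then show "\<exists>f\<in>D. (\<forall>z\<in>topspace X. beta_embed X z \<notin> U \<longrightarrow> f z = 0) \<and> T f y \<noteq> 0"
      using f(3) fD by (intro bexI[of _ f]) (auto simp: U'_def)
  qed
  then have "beta_embed X ` S \<subseteq> supp X D T y" by blast
  then show ?thesis
    using card_inj_on_le[OF inj_on_subset[OF inj S(2)] _ fin] by simp
qed

theorem theorem1p1:
  fixes X :: "'a topology" and Y :: "'b topology"
    and DX :: "('a \<Rightarrow> real) set" and DY :: "('b \<Rightarrow> real) set"
    and T :: "('a \<Rightarrow> real) \<Rightarrow> ('b \<Rightarrow> real)"
    and m :: nat
  assumes "tychonoff_space X" and "tychonoff_space Y"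
    and "m \<ge> 1"
    and "DX = C_space X \<or> DX = Cb_space X"
    and "DY = C_space Y \<or> DY = Cb_space Y"
    and "linear_map_on X Y DX T"
    and "continuous_map (pointwise_topology X DX) (pointwise_topology Y DY) T"
    and "T ` DX = DY"
    and "\<And>y. y \<in> topspace Y \<Longrightarrow> finite (supp X DX T y) \<and> card (supp X DX T y) \<le> m"
  shows "covering_dim Y \<le> enat m * covering_dim X"
proof (cases "\<exists>n. covering_dim_le X n")
  case False
  then have "covering_dim X = \<infinity>" by (simp add: covering_dim_def Inf_enat_def)
  \<comment> \<open>Here m \<ge> 1 gives m * \<infinity> = \<infinity>; for m = 0 the product would
    be 0.\<close>
  then show ?thesis using \<open>m \<ge> 1\<close> by (simp add: imult_is_infinity zero_enat_def)
next
  case True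
  then have "{enat n |n. covering_dim_le X n} \<noteq> {}" by blast
  \<comment> \<open>A nonempty set of extended naturals contains its infimum, so the bound holds
    with n equal to the dimension itself.\<close>
  then have "covering_dim X \<in> {enat n |n. covering_dim_le X n}"
    unfolding covering_dim_def Inf_enat_def by (simp only: if_False) (metis (no_types, lifting) LeastI ex_in_conv)
  then obtain n where n: "covering_dim X = enat n" "covering_dim_le X n" by blast
  interpret finitely_supported_surjection X Y DX T m n
  proof
    show "covering_dim_le X n" by (rule n)
    show "Cb_space X \<subseteq> DX" "DX \<subseteq> C_space X" using assms(4) by (auto simp: Cb_space_def)
    show "continuous_map Y euclideanreal (T f)" if "f \<in> DX" for f
    proof -
      have "T f \<in> DY" using assms(8) that by blast
      then show ?thesis using assms(5) by (auto simp: C_space_def Cb_space_def)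
    qed
    show "\<exists>f\<in>DX. \<forall>y\<in>topspace Y. T f y = g y"
      if g: "continuous_map Y euclideanreal g" "\<And>y. 0 \<le> g y \<and> g y \<le> 1" for g
    proof -
      have "restrict g (topspace Y) \<in> Cb_space Y"
        by (rule restrict_in_Cb_space[where b = 1]) (use g in auto)
      then have "restrict g (topspace Y) \<in> T ` DX" using assms(5,8) by (auto simp: Cb_space_def)
      then obtain f where "f \<in> DX" "T f = restrict g (topspace Y)" by (metis imageE)
      then show ?thesis by (intro bexI[of _ f]) auto
    qed
    fix y assume y: "y \<in> topspace Y"
    have "continuous_map (pointwise_topology X DX) (powertop_real (topspace Y)) T"
      using assms(7) by (simp add: pointwise_topology_def continuous_map_in_subtopology)
    then have cont: "continuous_map (pointwise_topology X DX) euclideanreal (\<lambda>f. T f y)"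
      using continuous_map_compose[OF _ continuous_map_product_projection[OF y, of "\<lambda>_. euclideanreal"]]
      by (auto simp: o_def)
    obtain S \<alpha> where S: "finite S" "S \<subseteq> topspace X" "\<And>x. x \<in> S \<Longrightarrow> \<alpha> x \<noteq> 0"
      "\<And>f. f \<in> DX \<Longrightarrow> T f y = (\<Sum>x\<in>S. \<alpha> x * f x)"
    proof (rule continuous_functional_finite_sum[OF assms(1,4) cont])
      show "T (\<lambda>x\<in>topspace X. f x + g x) y = T f y + T g y" if "f \<in> DX" "g \<in> DX" for f g
        using assms(6) that y by (simp add: linear_map_on_def)
      show "T (\<lambda>x\<in>topspace X. c * f x) y = c * T f y" if "f \<in> DX" for c f
        using assms(6) that y by (simp add: linear_map_on_def)
    qed blast
    have "card S \<le> card (supp X DX T y)"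
      by (rule finite_sum_support_card_le[OF assms(1,4), where \<alpha> = \<alpha>])
         (fact S | simp add: assms(9)[OF y])+
    then show "\<exists>S \<alpha>. finite S \<and> S \<subseteq> topspace X \<and> card S \<le> m \<and> (\<forall>f\<in>DX. T f y = (\<Sum>x\<in>S. \<alpha> x * f x))"
      using S assms(9)[OF y] by (intro exI[of _ S] exI[of _ \<alpha>]) auto
  qed
  have "covering_dim Y \<le> enat (m * n)"
    unfolding covering_dim_def by (rule Inf_lower) (use covering_dim_le_codomain in blast)
  then show ?thesis by (simp add: n(1))
qed

end
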